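(* Let $k\ge 1$ and $n\ge 1$ be integers. Then \[ m_{\mathsf{faithful}}\big(\mathrm{Hei}_{2k+1}(\mathcal{O}/\mathfrak{p}^n)\big)=\sum_{i=0}^{\xi-1} f\,q^{k(n-i)},\qquad \xi=\min\{e,n\}. \]
   Context: For a finite group $G$, $m_{\mathsf{faithful}}(G)$ denotes the smallest dimension of a faithful complex representation of $G$. $F$ is a non-Archimedean local field with discrete valuation $\nu$, ring of integers $\mathcal{O}$, maximal ideal $\mathfrak{p}$, and residue field $\mathcal{O}/\mathfrak{p}\cong\mathbb{F}_q$ with $q=p^f$ ($p$ prime); $f$ is the absolute inertia degree and $e=\nu(p)$ is the absolute ramification index (with $e=\infty$ when $F$ has characteristic $p$, e.g. $F=\mathbb{F}_q((T))$). For a commutative unital ring $R$, the Heisenberg group $\mathrm{Hei}_{2k+1}(R)$ is the group of $(k+2)\times(k+2)$ matrices $\begin{pmatrix}1&\mathbf{x}&z\\0&I_k&\mathbf{y}^T\\0&0&1\end{pmatrix}$ with $\mathbf{x},\mathbf{y}\in R^k$ (row vectors), $z\in R$, under matrix multiplication. *)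

theory Defs
  imports "HOL-Algebra.QuotRing" "HOL-Library.Extended_Nat"
          "HOL-Computational_Algebra.Primes" "Jordan_Normal_Form.Matrix"
begin

text \<open>A normalized discrete valuation on a field, given on nonzero elements
  (the value at 0 is conventionally +infinity and is never used).\<close>
definition discrete_valuation :: "('a::field \<Rightarrow> int) \<Rightarrow> bool" where
  "discrete_valuation \<nu> \<longleftrightarrow>
     (\<forall>x y. x \<noteq> 0 \<longrightarrow> y \<noteq> 0 \<longrightarrow> \<nu> (x * y) = \<nu> x + \<nu> y) \<and>
     (\<forall>x y. x \<noteq> 0 \<longrightarrow> y \<noteq> 0 \<longrightarrow> x + y \<noteq> 0 \<longrightarrow> \<nu> (x + y) \<ge> min (\<nu> x) (\<nu> y)) \<and>
     (\<forall>m. \<exists>x. x \<noteq> 0 \<and> \<nu> x = m)"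

definition val_ge :: "('a::field \<Rightarrow> int) \<Rightarrow> int \<Rightarrow> 'a \<Rightarrow> bool" where
  "val_ge \<nu> N x \<longleftrightarrow> x = 0 \<or> \<nu> x \<ge> N"

definition val_cauchy :: "('a::field \<Rightarrow> int) \<Rightarrow> (nat \<Rightarrow> 'a) \<Rightarrow> bool" where
  "val_cauchy \<nu> s \<longleftrightarrow> (\<forall>N. \<exists>M. \<forall>i\<ge>M. \<forall>j\<ge>M. val_ge \<nu> N (s i - s j))"

definition val_converges :: "('a::field \<Rightarrow> int) \<Rightarrow> (nat \<Rightarrow> 'a) \<Rightarrow> 'a \<Rightarrow> bool" where
  "val_converges \<nu> s L \<longleftrightarrow> (\<forall>N. \<exists>M. \<forall>i\<ge>M. val_ge \<nu> N (s i - L))"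

definition int_ring :: "('a::field \<Rightarrow> int) \<Rightarrow> 'a ring" where
  "int_ring \<nu> = \<lparr>carrier = {x. val_ge \<nu> 0 x}, monoid.mult = (*), one = 1,
                  zero = 0, add = (+)\<rparr>"

definition max_ideal_pow :: "('a::field \<Rightarrow> int) \<Rightarrow> nat \<Rightarrow> 'a set" where
  "max_ideal_pow \<nu> n = {x. val_ge \<nu> (int n) x}"

definition O_mod :: "('a::field \<Rightarrow> int) \<Rightarrow> nat \<Rightarrow> 'a set ring" where
  "O_mod \<nu> n = int_ring \<nu> Quot max_ideal_pow \<nu> n"

definition nonarch_local_field :: "('a::field \<Rightarrow> int) \<Rightarrow> bool" where
  "nonarch_local_field \<nu> \<longleftrightarrow> discrete_valuation \<nu> \<and>
     (\<forall>s. val_cauchy \<nu> s \<longrightarrow> (\<exists>L. val_converges \<nu> s L)) \<and>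
     finite (carrier (O_mod \<nu> 1))"

definition residue_card :: "('a::field \<Rightarrow> int) \<Rightarrow> nat" where
  "residue_card \<nu> = card (carrier (O_mod \<nu> 1))"

definition residue_char :: "('a::field \<Rightarrow> int) \<Rightarrow> nat" where
  "residue_char \<nu> = (LEAST m. m > 0 \<and> val_ge \<nu> 1 (of_nat m :: 'a))"

definition inertia_degree :: "('a::field \<Rightarrow> int) \<Rightarrow> nat" where
  "inertia_degree \<nu> = (THE f. residue_card \<nu> = residue_char \<nu> ^ f)"

definition ramification_index :: "('a::field \<Rightarrow> int) \<Rightarrow> enat" where
  "ramification_index \<nu> =
     (if (of_nat (residue_char \<nu>) :: 'a) = 0 then \<infinity>
      else enat (nat (\<nu> (of_nat (residue_char \<nu>)))))"

text \<open>The element with entries x, y (row vectors of length k, as lists) and z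
  of Hei_{2k+1}(R); matrix multiplication becomes
  (x,y,z)(x',y',z') = (x+x', y+y', z+z'+x.y'^T).\<close>
definition Hei :: "nat \<Rightarrow> ('b, 'm) ring_scheme \<Rightarrow> ('b list \<times> 'b list \<times> 'b) monoid" where
  "Hei k R = \<lparr>carrier = {(x, y, z). length x = k \<and> set x \<subseteq> carrier R \<and>
                                    length y = k \<and> set y \<subseteq> carrier R \<and> z \<in> carrier R},
     monoid.mult = (\<lambda>(x, y, z) (x', y', z').
        (map2 (add R) x x', map2 (add R) y y',
         z \<oplus>\<^bsub>R\<^esub> z' \<oplus>\<^bsub>R\<^esub> finsum R (\<lambda>i. x ! i \<otimes>\<^bsub>R\<^esub> y' ! i) {..<k})),
     one = (replicate k \<zero>\<^bsub>R\<^esub>, replicate k \<zero>\<^bsub>R\<^esub>, \<zero>\<^bsub>R\<^esub>)\<rparr>"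

definition faithful_rep :: "('g, 'h) monoid_scheme \<Rightarrow> nat \<Rightarrow> ('g \<Rightarrow> complex mat) \<Rightarrow> bool" where
  "faithful_rep G d \<rho> \<longleftrightarrow>
     (\<forall>g\<in>carrier G. \<rho> g \<in> carrier_mat d d \<and> invertible_mat (\<rho> g)) \<and>
     (\<forall>g\<in>carrier G. \<forall>h\<in>carrier G. \<rho> (g \<otimes>\<^bsub>G\<^esub> h) = \<rho> g * \<rho> h) \<and>
     inj_on \<rho> (carrier G)"

definition m_faithful :: "('g, 'h) monoid_scheme \<Rightarrow> nat" where
  "m_faithful G = (LEAST d. \<exists>\<rho>. faithful_rep G d \<rho>)"

end

theory Submission
  imports Defs
begin

text \<open>
  Put \<open>R = \<O>/\<pp>\<^sup>n\<close>, with ideals \<open>J i = \<pp>\<^sup>i/\<pp>\<^sup>n\<close>, and let \<open>\<psi>\<close> be a central character of the Heisenberg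
  group of level \<open>m\<close>, i.e. \<open>m\<close> is least such that \<open>\<psi>\<close> is trivial on \<open>J m\<close>.

  Lower bound: a faithful representation restricted to the abelian subgroup of all \<open>(x, 0, z)\<close>
  is diagonalizable. If \<open>v\<close> is a weight vector lying over \<open>\<psi>\<close>, the translates of \<open>v\<close> by \<open>(0, y, 0)\<close>
  have \<open>q\<^bsup>km\<^esup>\<close> distinct weights, because \<open>(x, y) \<mapsto> \<psi> (x \<cdot> y)\<close> is nondegenerate modulo \<open>J m\<close>. So the
  dimension is at least the sum of \<open>q\<^bsup>k level \<psi>\<^esup>\<close> over the occurring central characters. These separate
  the points of \<open>J (n - j)\<close>, which for \<open>j \<le> \<xi>\<close> is killed by \<open>p\<close> and has order \<open>p\<^bsup>fj\<^esup>\<close>; hence at least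
  \<open>f j\<close> of them have level greater than \<open>n - j\<close>, and summation by parts gives the bound.

  Upper bound: for each of the levels \<open>m = n - i\<close> with \<open>i < \<xi>\<close> choose \<open>f\<close> characters trivial on \<open>J m\<close>
  that separate \<open>J (m - 1)\<close> modulo \<open>J m\<close>. Their common kernel meets the \<open>p\<close>-torsion trivially, so it
  is zero, and the direct sum of the monomial representations
  \<open>(x, y, z) \<delta>\<^sub>t = \<psi> (z + x \<cdot> t) \<delta>\<^bsub>t+y\<^esub>\<close> with \<open>t \<in> (R / J m)\<^sup>k\<close> is faithful.
\<close>

subsection \<open>Joint eigenvectors of commuting matrices of finite order\<close>

text \<open>Given coordinate by coordinate, so that the dimension is \<open>d\<close> by
  construction, also for an empty index set.\<close>

definition vec_lincomb :: "nat \<Rightarrow> 'i set \<Rightarrow> ('i \<Rightarrow> complex) \<Rightarrow> ('i \<Rightarrow> complex vec) \<Rightarrow> complex vec" where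
  "vec_lincomb d I a u = vec d (\<lambda>r. \<Sum>i\<in>I. a i * u i $ r)"

lemma vec_lincomb_carrier [simp]: "vec_lincomb d I a u \<in> carrier_vec d"
  by (simp add: vec_lincomb_def)

lemma mult_mat_vec_index_sum:
  assumes "M \<in> carrier_mat d d" "v \<in> carrier_vec d" "r < d"
  shows "(M *\<^sub>v v) $ r = (\<Sum>s<d. M $$ (r, s) * v $ s)"
  using assms by (auto simp: scalar_prod_def atLeast0LessThan intro!: sum.cong)

lemma mult_mat_vec_lincomb:
  assumes "M \<in> carrier_mat d d" "\<And>i. i \<in> I \<Longrightarrow> u i \<in> carrier_vec d"
  shows "M *\<^sub>v vec_lincomb d I a u = vec_lincomb d I a (\<lambda>i. M *\<^sub>v u i)"
proof (rule eq_vecI)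
  fix r assume "r < dim_vec (vec_lincomb d I a (\<lambda>i. M *\<^sub>v u i))"
  then have r: "r < d" by (simp add: vec_lincomb_def)
  have "(M *\<^sub>v vec_lincomb d I a u) $ r = (\<Sum>s<d. M $$ (r, s) * (\<Sum>i\<in>I. a i * u i $ s))"
    using assms(1) r by (subst mult_mat_vec_index_sum) (auto simp: vec_lincomb_def)
  also have "\<dots> = (\<Sum>i\<in>I. a i * (\<Sum>s<d. M $$ (r, s) * u i $ s))"
    by (simp add: sum_distrib_left mult.left_commute) (rule sum.swap)
  also have "\<dots> = (\<Sum>i\<in>I. a i * (M *\<^sub>v u i) $ r)"
    using assms r by (intro sum.cong refl) (simp add: mult_mat_vec_index_sum del: index_mult_mat_vec)
  finally show "(M *\<^sub>v vec_lincomb d I a u) $ r = vec_lincomb d I a (\<lambda>i. M *\<^sub>v u i) $ r"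
    using r by (simp add: vec_lincomb_def)
qed (use assms in \<open>auto simp: vec_lincomb_def\<close>)

lemma vec_lincomb_cong:
  assumes "\<And>i. i \<in> I \<Longrightarrow> u i \<in> carrier_vec d" "\<And>i. i \<in> I \<Longrightarrow> w i = c i \<cdot>\<^sub>v u i"
  shows "vec_lincomb d I a w = vec_lincomb d I (\<lambda>i. a i * c i) u"
  unfolding vec_lincomb_def
proof (rule eq_vecI, goal_cases)
  case (1 r)
  have "u i $ r * c i = w i $ r" if "i \<in> I" for i
    using assms(1)[OF that] assms(2)[OF that] 1 by auto
  then show ?case
    using 1 by (auto intro!: sum.cong simp: mult.assoc) (metis mult.commute)
qed auto

text \<open>A geometric sum whose ratio \<open>\<omega> ^ j\<close> differs from 1 for
  \<open>j \<noteq> 0\<close> but has \<open>N\<close>-th power 1. This orthogonality recovers a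
  vector from its eigenprojections.\<close>

lemma sum_root_of_unity_powers:
  fixes N :: nat
  defines "\<omega> \<equiv> cis (2 * pi / N)"
  assumes "j < N"
  shows "(\<Sum>t<N. (\<omega> ^ t) ^ j) = (if j = 0 then of_nat N else 0)"
proof (cases "j = 0")
  case False
  have inj: "inj_on (\<lambda>k. cis (2 * pi * real k / real N)) {..<N}"
    using bij_betw_roots_unity[of N] assms by (auto simp: bij_betw_def)
  have pw: "\<omega> ^ i = cis (2 * pi * real i / real N)" for i
    unfolding \<omega>_def by (simp add: DeMoivre mult.commute mult.left_commute)
  have "\<omega> ^ j \<noteq> 1"
    using inj_onD[OF inj, of j 0] assms(2) False unfolding pw by auto
  moreover have "(\<omega> ^ j) ^ N = 1"
    using assms by (simp add: \<omega>_def DeMoivre flip: power_mult)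
      (metis cis_multiple_2pi Ints_of_nat mult.commute mult.left_commute)
  ultimately show ?thesis
    using False geometric_sum[of "\<omega> ^ j" N] by (simp add: mult.commute flip: power_mult)
qed auto

text \<open>If \<open>M ^\<^sub>m N\<close> is the identity and \<open>\<eta> ^ N = 1\<close>, this
  is \<open>N\<close> times the projection onto the eigenspace of \<open>M\<close> for the
  eigenvalue \<open>inverse \<eta>\<close>.\<close>

definition eigen_proj :: "nat \<Rightarrow> nat \<Rightarrow> complex mat \<Rightarrow> complex \<Rightarrow> complex vec \<Rightarrow> complex vec" where
  "eigen_proj d N M \<eta> v = vec_lincomb d {..<N} (\<lambda>j. \<eta> ^ j) (\<lambda>j. (M ^\<^sub>m j) *\<^sub>v v)"

context
  fixes d N :: nat and M :: "complex mat"
  assumes M: "M \<in> carrier_mat d d" and N: "N > 0" and MN: "M ^\<^sub>m N = 1\<^sub>m d"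
begin

lemma pow_vec_carrier [simp]: "v \<in> carrier_vec d \<Longrightarrow> (M ^\<^sub>m j) *\<^sub>v v \<in> carrier_vec d"
  using M by (meson mult_mat_vec_carrier pow_carrier_mat)

lemma pow_Suc_vec: "v \<in> carrier_vec d \<Longrightarrow> M *\<^sub>v ((M ^\<^sub>m j) *\<^sub>v v) = (M ^\<^sub>m Suc j) *\<^sub>v v"
proof -
  assume v: "v \<in> carrier_vec d"
  have "M * M ^\<^sub>m j = M ^\<^sub>m j * M"
  proof (induction j)
    case (Suc j)
    then show ?case
      using assoc_mult_mat[OF M pow_carrier_mat[OF M] M, of j] by simp
  qed (use M in auto)
  then show ?thesis
    using M v by (simp add: assoc_mult_mat_vec[of _ d d _ d, symmetric] pow_carrier_mat)
qed

lemma eigen_proj_eigen: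
  assumes v: "v \<in> carrier_vec d" and \<eta>: "\<eta> ^ N = 1"
  shows "M *\<^sub>v eigen_proj d N M \<eta> v = inverse \<eta> \<cdot>\<^sub>v eigen_proj d N M \<eta> v"
proof -
  have \<eta>0: "\<eta> \<noteq> 0" using \<eta> N by (metis power_0_left less_irrefl zero_neq_one)
  let ?u = "\<lambda>j. (M ^\<^sub>m j) *\<^sub>v v"
  have "M *\<^sub>v eigen_proj d N M \<eta> v = vec_lincomb d {..<N} (\<lambda>j. \<eta> ^ j) (\<lambda>j. ?u (Suc j))"
    unfolding eigen_proj_def using M v
    by (subst mult_mat_vec_lincomb) (auto simp: pow_Suc_vec simp del: pow_mat.simps)
  also have "\<dots> = inverse \<eta> \<cdot>\<^sub>v eigen_proj d N M \<eta> v"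
  proof (rule eq_vecI)
    fix r assume "r < dim_vec (inverse \<eta> \<cdot>\<^sub>v eigen_proj d N M \<eta> v)"
    then have r: "r < d" by (simp add: eigen_proj_def vec_lincomb_def)
    define g where "g = (\<lambda>j. \<eta> ^ j * ?u j $ r)"
    \<comment> \<open>The terms are periodic with period \<open>N\<close>, so the index shift caused
      by \<open>M\<close> only permutes them cyclically.\<close>
    have "g N = g 0" using v MN M \<eta> by (simp add: g_def)
    then have "(\<Sum>j<N. g (Suc j)) = (\<Sum>j<N. g j)"
      using sum.lessThan_Suc_shift[of g N] sum.lessThan_Suc[of g N] by simp
    moreover have "\<eta> ^ j * ?u (Suc j) $ r = inverse \<eta> * g (Suc j)" for j
      using \<eta>0 by (simp add: g_def)
    ultimately have "(\<Sum>j<N. \<eta> ^ j * ?u (Suc j) $ r) = inverse \<eta> * (\<Sum>j<N. g j)"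
      by (simp only: flip: sum_distrib_left)
    then show "vec_lincomb d {..<N} (\<lambda>j. \<eta> ^ j) (\<lambda>j. ?u (Suc j)) $ r
        = (inverse \<eta> \<cdot>\<^sub>v eigen_proj d N M \<eta> v) $ r"
      using r by (simp add: eigen_proj_def vec_lincomb_def g_def del: pow_mat.simps)
  qed (auto simp: eigen_proj_def vec_lincomb_def)
  finally show ?thesis .
qed

text \<open>Since \<open>B\<close> commutes with all powers of \<open>M\<close>, projecting an
  eigenvector of \<open>B\<close> to an eigenspace of \<open>M\<close> keeps its eigenvalue. Joint
  eigenvectors are built this way, one matrix at a time.\<close>

lemma eigen_proj_commute:
  assumes v: "v \<in> carrier_vec d" and B: "B \<in> carrier_mat d d" "B * M = M * B" "B *\<^sub>v v = c \<cdot>\<^sub>v v"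
  shows "B *\<^sub>v eigen_proj d N M \<eta> v = c \<cdot>\<^sub>v eigen_proj d N M \<eta> v"
proof -
  have comm: "B * M ^\<^sub>m j = M ^\<^sub>m j * B" for j
  proof (induction j)
    case (Suc j)
    note Mj = pow_carrier_mat[OF M, of j]
    have "B * (M ^\<^sub>m j * M) = M ^\<^sub>m j * (B * M)"
      using assoc_mult_mat[OF B(1) Mj M] assoc_mult_mat[OF Mj B(1) M] Suc by simp
    also have "\<dots> = M ^\<^sub>m j * M * B"
      using assoc_mult_mat[OF Mj M B(1)] B(2) by simp
    finally show ?case by simp
  qed (use M B in auto)
  have "B *\<^sub>v ((M ^\<^sub>m j) *\<^sub>v v) = c \<cdot>\<^sub>v ((M ^\<^sub>m j) *\<^sub>v v)" for j
  proof -
    have "B *\<^sub>v ((M ^\<^sub>m j) *\<^sub>v v) = (M ^\<^sub>m j) *\<^sub>v (B *\<^sub>v v)"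
      using M B(1) v comm[of j]
      by (simp add: assoc_mult_mat_vec[of _ d d _ d, symmetric] pow_carrier_mat)
    then show ?thesis
      using M v by (simp add: B(3) mult_mat_vec[of _ d d] pow_carrier_mat)
  qed
  then have "B *\<^sub>v eigen_proj d N M \<eta> v = vec_lincomb d {..<N} (\<lambda>j. \<eta> ^ j * c) (\<lambda>j. (M ^\<^sub>m j) *\<^sub>v v)"
    unfolding eigen_proj_def using v B(1)
    by (subst mult_mat_vec_lincomb) (auto intro!: vec_lincomb_cong)
  also have "\<dots> = c \<cdot>\<^sub>v eigen_proj d N M \<eta> v"
    by (auto simp: eigen_proj_def vec_lincomb_def sum_distrib_left intro!: eq_vecI sum.cong)
  finally show ?thesis .
qed

text \<open>After interchanging the two sums, orthogonality of the roots of unity leaves only the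
  term \<open>j = 0\<close>.\<close>

lemma eigen_proj_decomposition:
  assumes v: "v \<in> carrier_vec d"
  shows "of_nat N \<cdot>\<^sub>v v = vec_lincomb d {..<N} (\<lambda>t. 1) (\<lambda>t. eigen_proj d N M (cis (2 * pi / N) ^ t) v)"
proof (rule eq_vecI)
  let ?\<omega> = "cis (2 * pi / N)"
  fix r assume "r < dim_vec (vec_lincomb d {..<N} (\<lambda>t. 1) (\<lambda>t. eigen_proj d N M (?\<omega> ^ t) v))"
  then have r: "r < d" by (simp add: vec_lincomb_def)
  have "(\<Sum>t<N. \<Sum>j<N. (?\<omega> ^ t) ^ j * ((M ^\<^sub>m j) *\<^sub>v v) $ r)
      = (\<Sum>j<N. (\<Sum>t<N. (?\<omega> ^ t) ^ j) * ((M ^\<^sub>m j) *\<^sub>v v) $ r)"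
    unfolding sum_distrib_right by (rule sum.swap)
  also have "\<dots> = (\<Sum>j<N. if j = 0 then of_nat N * ((M ^\<^sub>m j) *\<^sub>v v) $ r else 0)"
    by (rule sum.cong) (auto simp: sum_root_of_unity_powers)
  also have "\<dots> = of_nat N * v $ r"
    using N M v by simp
  finally show "(of_nat N \<cdot>\<^sub>v v) $ r
      = vec_lincomb d {..<N} (\<lambda>t. 1) (\<lambda>t. eigen_proj d N M (?\<omega> ^ t) v) $ r"
    using r v by (simp add: vec_lincomb_def eigen_proj_def)
qed (use v in \<open>auto simp: vec_lincomb_def\<close>)

lemma root_of_unity_power_one: "(cis (2 * pi / real N) ^ t) ^ N = 1"
  using N by (simp add: DeMoivre flip: power_mult)
    (metis cis_multiple_2pi Ints_of_nat mult.commute mult.left_commute)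

text \<open>The projections add up to \<open>N\<close> times \<open>v\<close>, so they cannot all
  vanish.\<close>

lemma exists_eigen_proj_nonzero:
  assumes v: "v \<in> carrier_vec d" "v \<noteq> 0\<^sub>v d"
  shows "\<exists>\<eta>. \<eta> ^ N = 1 \<and> eigen_proj d N M \<eta> v \<noteq> 0\<^sub>v d"
proof (rule ccontr)
  assume "\<not> ?thesis"
  then have "eigen_proj d N M (cis (2 * pi / N) ^ t) v = 0\<^sub>v d" for t
    using root_of_unity_power_one by blast
  then have "of_nat N \<cdot>\<^sub>v v = vec_lincomb d {..<N} (\<lambda>t. 1) (\<lambda>t. 0\<^sub>v d)"
    using eigen_proj_decomposition[OF v(1)] by simp
  also have "\<dots> = 0\<^sub>v d"
    by (auto simp: vec_lincomb_def)
  finally have "inverse (of_nat N) \<cdot>\<^sub>v (complex_of_nat N \<cdot>\<^sub>v v) = 0\<^sub>v d"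
    by auto
  then show False using v N by (simp add: smult_smult_assoc)
qed

text \<open>Otherwise \<open>M\<close> would fix every eigenprojection of \<open>v\<close>, hence
  also their sum, which is \<open>N\<close> times \<open>v\<close>.\<close>

lemma exists_nontrivial_eigenvector:
  assumes v: "v \<in> carrier_vec d" "M *\<^sub>v v \<noteq> v"
  shows "\<exists>w c. w \<in> carrier_vec d \<and> w \<noteq> 0\<^sub>v d \<and> c \<noteq> 1 \<and> M *\<^sub>v w = c \<cdot>\<^sub>v w"
proof (rule ccontr)
  assume no: "\<not> ?thesis"
  let ?P = "\<lambda>t. eigen_proj d N M (cis (2 * pi / N) ^ t) v"
  have P: "?P t \<in> carrier_vec d" for t by (simp add: eigen_proj_def)
  have fix1: "M *\<^sub>v ?P t = ?P t" for t
  proof (cases "?P t = 0\<^sub>v d")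
    case True
    then show ?thesis using M by auto
  next
    case False
    then have "inverse (cis (2 * pi / N) ^ t) = 1"
      using no eigen_proj_eigen[OF v(1) root_of_unity_power_one] P by blast
    then show ?thesis
      using eigen_proj_eigen[OF v(1) root_of_unity_power_one, of t] by (metis one_smult_vec)
  qed
  have "M *\<^sub>v (of_nat N \<cdot>\<^sub>v v) = of_nat N \<cdot>\<^sub>v v"
    unfolding eigen_proj_decomposition[OF v(1)] using M P
    by (subst mult_mat_vec_lincomb) (auto simp: fix1)
  then have "complex_of_nat N \<cdot>\<^sub>v (M *\<^sub>v v) = of_nat N \<cdot>\<^sub>v v"
    using M v by (simp add: mult_mat_vec)
  then have "inverse (of_nat N) \<cdot>\<^sub>v (complex_of_nat N \<cdot>\<^sub>v (M *\<^sub>v v))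
      = inverse (of_nat N) \<cdot>\<^sub>v (complex_of_nat N \<cdot>\<^sub>v v)" by simp
  then show False using v N by (simp add: smult_smult_assoc)
qed

end

lemma mat_eqI_mult_vec:
  fixes A B :: "complex mat"
  assumes "A \<in> carrier_mat d d" "B \<in> carrier_mat d d"
    and eq: "\<And>v. v \<in> carrier_vec d \<Longrightarrow> A *\<^sub>v v = B *\<^sub>v v"
  shows "A = B"
proof (rule eq_matI)
  fix i j assume "i < dim_row B" "j < dim_col B"
  then have ij: "i < d" "j < d" using assms by auto
  have "C $$ (i, j) = (C *\<^sub>v unit_vec d j) $ i" if "C \<in> carrier_mat d d" for C :: "complex mat"
    using that ij by simp
  then show "A $$ (i, j) = B $$ (i, j)" by (metis assms(1,2) eq unit_vec_carrier)
qed (use assms in auto)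

text \<open>An eigenvector of \<open>M0\<close> for an eigenvalue \<open>c0 \<noteq> 1\<close> is
  projected to eigenspaces of the members of \<open>\<M>\<close> one after another; commutativity
  keeps every eigenvalue found before, in particular \<open>c0\<close>.\<close>

lemma exists_joint_eigenvector:
  fixes \<M> :: "complex mat set"
  assumes fin: "finite \<M>" and car: "\<And>M. M \<in> \<M> \<Longrightarrow> M \<in> carrier_mat d d"
    and comm: "\<And>A B. A \<in> \<M> \<Longrightarrow> B \<in> \<M> \<Longrightarrow> A * B = B * A"
    and ord: "\<And>M. M \<in> \<M> \<Longrightarrow> \<exists>N>0. M ^\<^sub>m N = 1\<^sub>m d"
    and M0: "M0 \<in> \<M>" "M0 \<noteq> 1\<^sub>m d"
  shows "\<exists>v c0. v \<in> carrier_vec d \<and> v \<noteq> 0\<^sub>v d \<and> c0 \<noteq> 1 \<and> M0 *\<^sub>v v = c0 \<cdot>\<^sub>v v \<and>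
           (\<forall>M\<in>\<M>. \<exists>c. M *\<^sub>v v = c \<cdot>\<^sub>v v)"
proof -
  have M0c: "M0 \<in> carrier_mat d d" using car M0 by simp
  have "\<exists>v\<in>carrier_vec d. M0 *\<^sub>v v \<noteq> v"
  proof (rule ccontr)
    assume "\<not> ?thesis"
    then have "M0 *\<^sub>v v = 1\<^sub>m d *\<^sub>v v" if "v \<in> carrier_vec d" for v using that by simp
    then have "M0 = 1\<^sub>m d"
      using M0c by (intro mat_eqI_mult_vec[of _ d]) auto
    then show False using M0 by simp
  qed
  then obtain w0 c0 where w0: "w0 \<in> carrier_vec d" "w0 \<noteq> 0\<^sub>v d" "c0 \<noteq> 1" "M0 *\<^sub>v w0 = c0 \<cdot>\<^sub>v w0"
    using exists_nontrivial_eigenvector[OF M0c] ord[OF M0(1)] by metis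
  have "\<exists>v. v \<in> carrier_vec d \<and> v \<noteq> 0\<^sub>v d \<and> M0 *\<^sub>v v = c0 \<cdot>\<^sub>v v \<and> (\<forall>M\<in>F. \<exists>c. M *\<^sub>v v = c \<cdot>\<^sub>v v)"
    if "F \<subseteq> \<M>" "finite F" for F
    using that(2,1)
  proof (induction F rule: finite_induct)
    case empty
    then show ?case using w0 by auto
  next
    case (insert M F)
    then obtain v where v: "v \<in> carrier_vec d" "v \<noteq> 0\<^sub>v d" "M0 *\<^sub>v v = c0 \<cdot>\<^sub>v v"
      "\<And>B. B \<in> F \<Longrightarrow> \<exists>c. B *\<^sub>v v = c \<cdot>\<^sub>v v" by auto
    have M: "M \<in> \<M>" "M \<in> carrier_mat d d" using insert car by auto
    obtain N where N: "N > 0" "M ^\<^sub>m N = 1\<^sub>m d" using ord M by blast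
    obtain \<eta> where \<eta>: "\<eta> ^ N = 1" "eigen_proj d N M \<eta> v \<noteq> 0\<^sub>v d"
      using exists_eigen_proj_nonzero[OF M(2) N v(1,2)] by blast
    have "\<exists>c. B *\<^sub>v eigen_proj d N M \<eta> v = c \<cdot>\<^sub>v eigen_proj d N M \<eta> v" if "B \<in> F" for B
      using eigen_proj_commute[OF M(2) N v(1), of B] v(4)[OF that] that insert car comm M by blast
    moreover have "M0 *\<^sub>v eigen_proj d N M \<eta> v = c0 \<cdot>\<^sub>v eigen_proj d N M \<eta> v"
      using eigen_proj_commute[OF M(2) N v(1) M0c] comm M M0 v(3) by blast
    moreover have "\<exists>c. M *\<^sub>v eigen_proj d N M \<eta> v = c \<cdot>\<^sub>v eigen_proj d N M \<eta> v"
      using eigen_proj_eigen[OF M(2) N v(1) \<eta>(1)] by blast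
    ultimately show ?case
      using \<eta>(2) by (intro exI[of _ "eigen_proj d N M \<eta> v"]) (auto simp: eigen_proj_def)
  qed
  from this[OF subset_refl fin] show ?thesis using w0(3) by blast
qed

section \<open>Linear relations, and independence of eigenvectors with distinct weights\<close>

lemma nontrivial_linear_relation:
  fixes w :: "'i \<Rightarrow> nat \<Rightarrow> complex"
  assumes "finite I" "card I > d"
  shows "\<exists>a. (\<exists>i\<in>I. a i \<noteq> 0) \<and> (\<forall>r<d. (\<Sum>i\<in>I. a i * w i r) = 0)"
  using assms
proof (induction d arbitrary: I w)
  case 0
  then have "I \<noteq> {}" by auto
  then show ?case by (intro exI[of _ "\<lambda>_. 1"]) auto
next
  case (Suc d)
  show ?case
  proof (cases "\<forall>i\<in>I. w i d = 0")
    case True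
    obtain a where "\<exists>i\<in>I. a i \<noteq> 0" "\<forall>r<d. (\<Sum>i\<in>I. a i * w i r) = 0"
      using Suc.IH[of I w] Suc.prems by auto
    then show ?thesis using True by (intro exI[of _ a]) (auto simp: less_Suc_eq)
  next
    case False
    then obtain j where j: "j \<in> I" "w j d \<noteq> 0" by blast
    have fin: "finite (I - {j})" using Suc.prems by simp
    have "card (I - {j}) > d" using Suc.prems j by simp
    \<comment> \<open>Gaussian elimination with pivot \<open>j\<close>: subtracting multiples of
      \<open>w j\<close> clears coordinate \<open>d\<close>, which leaves one vector and one
      coordinate fewer.\<close>
    from Suc.IH[OF fin this, of "\<lambda>i r. w i r - w i d / w j d * w j r"]
    obtain a where a: "\<exists>i\<in>I - {j}. a i \<noteq> 0"
      "\<And>r. r < d \<Longrightarrow> (\<Sum>i\<in>I - {j}. a i * (w i r - w i d / w j d * w j r)) = 0" by blast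
    \<comment> \<open>The coefficient of \<open>w j\<close> collects the subtracted multiples, which
      turns the relation into one between the original vectors.\<close>
    define b where "b = a(j := - (\<Sum>i\<in>I - {j}. a i * (w i d / w j d)))"
    have eq: "(\<Sum>i\<in>I. b i * w i r) = (\<Sum>i\<in>I - {j}. a i * (w i r - w i d / w j d * w j r))" for r
    proof -
      have "(\<Sum>i\<in>I. b i * w i r) = b j * w j r + (\<Sum>i\<in>I - {j}. b i * w i r)"
        using j Suc.prems by (simp add: sum.remove)
      also have "(\<Sum>i\<in>I - {j}. b i * w i r) = (\<Sum>i\<in>I - {j}. a i * w i r)"
        by (rule sum.cong) (auto simp: b_def)
      also have "b j * w j r = - (\<Sum>i\<in>I - {j}. a i * (w i d / w j d * w j r))"
        by (simp add: b_def sum_distrib_right mult.assoc)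
      finally show ?thesis
        by (simp add: sum_subtractf right_diff_distrib)
    qed
    have "(\<Sum>i\<in>I. b i * w i r) = 0" if "r < Suc d" for r
      using that a(2) j(2) unfolding eq by (auto simp: less_Suc_eq)
    moreover have "\<exists>i\<in>I. b i \<noteq> 0" using a(1) by (auto simp: b_def)
    ultimately show ?thesis by blast
  qed
qed

text \<open>Joint eigenvectors with pairwise different systems of eigenvalues are linearly
  independent. The separating \<open>k\<close> may depend on the pair.\<close>

lemma card_distinct_weights_le:
  fixes w :: "'i \<Rightarrow> complex vec" and A :: "'k \<Rightarrow> complex mat" and c :: "'k \<Rightarrow> 'i \<Rightarrow> complex"
  assumes fin: "finite I" and car: "\<And>k. k \<in> K \<Longrightarrow> A k \<in> carrier_mat d d"
    and w: "\<And>i. i \<in> I \<Longrightarrow> w i \<in> carrier_vec d" "\<And>i. i \<in> I \<Longrightarrow> w i \<noteq> 0\<^sub>v d"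
    and eig: "\<And>k i. k \<in> K \<Longrightarrow> i \<in> I \<Longrightarrow> A k *\<^sub>v w i = c k i \<cdot>\<^sub>v w i"
    and sep: "\<And>i j. i \<in> I \<Longrightarrow> j \<in> I \<Longrightarrow> i \<noteq> j \<Longrightarrow> \<exists>k\<in>K. c k i \<noteq> c k j"
  shows "card I \<le> d"
proof (rule ccontr)
  have indep: "\<forall>i\<in>F. a i = 0" if "finite F" "F \<subseteq> I" "vec_lincomb d F a w = 0\<^sub>v d" for F a
    using that
  proof (induction F arbitrary: a rule: finite_induct)
    case (insert j F)
    have comp: "a j * w j $ r + (\<Sum>i\<in>F. a i * w i $ r) = 0" if "r < d" for r
      using arg_cong[OF insert.prems(2), of "\<lambda>v. v $ r"] that insert.hyps
      by (simp add: vec_lincomb_def)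
    \<comment> \<open>Applying \<open>A k - c k j\<close> to the relation eliminates
      \<open>w j\<close>, so the induction hypothesis applies to the modified coefficients. For each
      \<open>i\<close>, a \<open>k\<close> separating it from \<open>j\<close> then gives
      \<open>a i = 0\<close>.\<close>
    have "\<forall>i\<in>F. a i * (c k i - c k j) = 0" if k: "k \<in> K" for k
    proof (rule insert.IH)
      have "vec_lincomb d (insert j F) (\<lambda>i. a i * c k i) w = A k *\<^sub>v vec_lincomb d (insert j F) a w"
        using car[OF k] w insert.prems(1) eig[OF k]
        by (subst mult_mat_vec_lincomb) (auto intro!: vec_lincomb_cong[symmetric])
      also have "\<dots> = 0\<^sub>v d" using insert.prems(2) car[OF k] by auto
      finally have 1: "a j * c k j * w j $ r + (\<Sum>i\<in>F. a i * c k i * w i $ r) = 0" if "r < d" for r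
        using that insert.hyps by (auto simp: vec_lincomb_def dest!: arg_cong[of _ _ "\<lambda>v. v $ r"])
      show "vec_lincomb d F (\<lambda>i. a i * (c k i - c k j)) w = 0\<^sub>v d"
      proof (rule eq_vecI)
        fix r assume "r < dim_vec (0\<^sub>v d)"
        then have r: "r < d" by simp
        have "(\<Sum>i\<in>F. a i * (c k i - c k j) * w i $ r)
          = (a j * c k j * w j $ r + (\<Sum>i\<in>F. a i * c k i * w i $ r))
            - c k j * (a j * w j $ r + (\<Sum>i\<in>F. a i * w i $ r))"
          by (simp add: algebra_simps sum_subtractf sum_distrib_left)
        then show "vec_lincomb d F (\<lambda>i. a i * (c k i - c k j)) w $ r = 0\<^sub>v d $ r"
          using r comp[OF r] 1[OF r] by (simp add: vec_lincomb_def)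
      qed (simp add: vec_lincomb_def)
    qed (use insert.prems in auto)
    then have F0: "a i = 0" if "i \<in> F" for i
      using sep[of i j] that insert by fastforce
    have "a j \<cdot>\<^sub>v w j = 0\<^sub>v d"
    proof (rule eq_vecI)
      fix r assume "r < dim_vec (0\<^sub>v d)"
      then show "(a j \<cdot>\<^sub>v w j) $ r = 0\<^sub>v d $ r"
        using comp[of r] F0 w(1)[of j] insert.prems by simp
    qed (use w insert.prems in auto)
    moreover have "w j = inverse (a j) \<cdot>\<^sub>v (a j \<cdot>\<^sub>v w j)" if "a j \<noteq> 0"
      using that by (simp add: smult_smult_assoc)
    ultimately have "a j = 0"
      using w(2)[of j] insert.prems by fastforce
    then show ?case using F0 by auto
  qed auto
  assume "\<not> card I \<le> d"
  then obtain a where "\<exists>i\<in>I. a i \<noteq> 0" "\<And>r. r < d \<Longrightarrow> (\<Sum>i\<in>I. a i * w i $ r) = 0"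
    using nontrivial_linear_relation[OF fin, of d "\<lambda>i r. w i $ r"] by auto
  moreover from this have "vec_lincomb d I a w = 0\<^sub>v d" by (auto simp: vec_lincomb_def)
  ultimately show False using indep[OF fin subset_refl] by blast
qed

subsection \<open>Monomial representations\<close>

text \<open>The matrix that sends the basis vector at \<open>b\<close> to \<open>\<alpha> b\<close>
  times the basis vector at \<open>\<sigma> b\<close>; \<open>en\<close> numbers the basis by
  natural numbers.\<close>

definition monomial_mat :: "nat \<Rightarrow> (nat \<Rightarrow> 'b) \<Rightarrow> ('b \<Rightarrow> 'b) \<Rightarrow> ('b \<Rightarrow> complex) \<Rightarrow> complex mat" where
  "monomial_mat d en \<sigma> \<alpha> = mat d d (\<lambda>(i, j). if en i = \<sigma> (en j) then \<alpha> (en j) else 0)"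

lemma monomial_mat_carrier [simp]: "monomial_mat d en \<sigma> \<alpha> \<in> carrier_mat d d"
  by (simp add: monomial_mat_def)

context
  fixes d :: nat and en :: "nat \<Rightarrow> 'b" and B :: "'b set"
  assumes en: "bij_betw en {..<d} B"
begin

lemma enum_mem: "i < d \<Longrightarrow> en i \<in> B"
  using en by (auto simp: bij_betw_def)

lemma enum_eq_iff: "i < d \<Longrightarrow> j < d \<Longrightarrow> en i = en j \<longleftrightarrow> i = j"
  using en by (auto simp: bij_betw_def inj_on_def)

lemma enum_obtain: assumes "b \<in> B" obtains i where "i < d" "en i = b"
  using en assms by (auto simp: bij_betw_def)

lemma monomial_mat_mult:
  assumes \<tau>: "\<And>b. b \<in> B \<Longrightarrow> \<tau> b \<in> B"
  shows "monomial_mat d en \<sigma> \<alpha> * monomial_mat d en \<tau> \<beta>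
    = monomial_mat d en (\<lambda>b. \<sigma> (\<tau> b)) (\<lambda>b. \<alpha> (\<tau> b) * \<beta> b)"
proof (rule eq_matI)
  fix i j assume "i < dim_row (monomial_mat d en (\<lambda>b. \<sigma> (\<tau> b)) (\<lambda>b. \<alpha> (\<tau> b) * \<beta> b))"
    "j < dim_col (monomial_mat d en (\<lambda>b. \<sigma> (\<tau> b)) (\<lambda>b. \<alpha> (\<tau> b) * \<beta> b))"
  then have ij: "i < d" "j < d" by (auto simp: monomial_mat_def)
  \<comment> \<open>The only index that contributes to the entry of the product.\<close>
  obtain k0 where k0: "k0 < d" "en k0 = \<tau> (en j)"
    using enum_obtain[OF \<tau>[OF enum_mem[OF ij(2)]]] by blast
  have "(monomial_mat d en \<sigma> \<alpha> * monomial_mat d en \<tau> \<beta>) $$ (i, j)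
    = (\<Sum>k<d. (if en i = \<sigma> (en k) then \<alpha> (en k) else 0) * (if en k = \<tau> (en j) then \<beta> (en j) else 0))"
    using ij by (auto simp: monomial_mat_def scalar_prod_def atLeast0LessThan intro!: sum.cong)
  also have "\<dots> = (\<Sum>k<d. if k = k0 then (if en i = \<sigma> (en k) then \<alpha> (en k) else 0) * \<beta> (en j) else 0)"
    using k0 by (intro sum.cong) (auto simp flip: enum_eq_iff)
  also have "\<dots> = (if en i = \<sigma> (\<tau> (en j)) then \<alpha> (\<tau> (en j)) * \<beta> (en j) else 0)"
    using k0 by (simp add: k0)
  finally show "(monomial_mat d en \<sigma> \<alpha> * monomial_mat d en \<tau> \<beta>) $$ (i, j)
      = monomial_mat d en (\<lambda>b. \<sigma> (\<tau> b)) (\<lambda>b. \<alpha> (\<tau> b) * \<beta> b) $$ (i, j)"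
    using ij by (simp add: monomial_mat_def)
qed (auto simp: monomial_mat_def)

lemma monomial_mat_cong:
  assumes "\<And>b. b \<in> B \<Longrightarrow> \<sigma> b = \<tau> b \<and> \<alpha> b = \<beta> b"
  shows "monomial_mat d en \<sigma> \<alpha> = monomial_mat d en \<tau> \<beta>"
  by (rule eq_matI) (use assms enum_mem in \<open>auto simp: monomial_mat_def\<close>)

lemma monomial_mat_id: "monomial_mat d en (\<lambda>b. b) (\<lambda>b. 1) = 1\<^sub>m d"
  by (rule eq_matI) (auto simp: monomial_mat_def enum_eq_iff)

text \<open>Column \<open>b\<close> has its nonzero entry in row \<open>\<sigma> b\<close>; the
  other matrix must agree there, which fixes both the position and the weight of its entry.\<close>

lemma monomial_mat_eqD:
  assumes eq: "monomial_mat d en \<sigma> \<alpha> = monomial_mat d en \<tau> \<beta>"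
    and b: "b \<in> B" "\<sigma> b \<in> B" "\<alpha> b \<noteq> 0"
  shows "\<sigma> b = \<tau> b \<and> \<alpha> b = \<beta> b"
proof -
  obtain i where i: "i < d" "en i = \<sigma> b" using enum_obtain[OF b(2)] by blast
  obtain j where j: "j < d" "en j = b" using enum_obtain[OF b(1)] by blast
  have "monomial_mat d en \<sigma> \<alpha> $$ (i, j) = monomial_mat d en \<tau> \<beta> $$ (i, j)"
    using eq by simp
  then show ?thesis using i j b(3) by (auto simp: monomial_mat_def split: if_splits)
qed

lemma invertible_monomial_mat:
  assumes \<sigma>: "bij_betw \<sigma> B B" and nz: "\<And>b. b \<in> B \<Longrightarrow> \<alpha> b \<noteq> 0"
  shows "invertible_mat (monomial_mat d en \<sigma> \<alpha>)"
proof -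
  let ?\<tau> = "inv_into B \<sigma>"
  let ?N = "monomial_mat d en ?\<tau> (\<lambda>b. inverse (\<alpha> (?\<tau> b)))"
  have \<tau>: "?\<tau> b \<in> B" "\<sigma> (?\<tau> b) = b" "?\<tau> (\<sigma> b) = b" "\<sigma> b \<in> B" if "b \<in> B" for b
    using \<sigma> that bij_betw_inv_into[OF \<sigma>] 
    by (auto simp: bij_betw_def f_inv_into_f inv_into_into)
  have "monomial_mat d en \<sigma> \<alpha> * ?N = 1\<^sub>m d"
    using \<tau> nz by (subst monomial_mat_mult) (auto simp flip: monomial_mat_id intro!: monomial_mat_cong)
  moreover have "?N * monomial_mat d en \<sigma> \<alpha> = 1\<^sub>m d"
    using \<tau> nz by (subst monomial_mat_mult) (auto simp flip: monomial_mat_id intro!: monomial_mat_cong)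
  ultimately show ?thesis
    unfolding invertible_mat_def inverts_mat_def
    by (intro conjI exI[of _ ?N]) (auto simp: monomial_mat_def)
qed

end

text \<open>Turns an action \<open>\<sigma>\<close> on a finite set with a cocycle
  \<open>\<alpha>\<close> into a representation, so that multiplicativity and faithfulness can be
  checked pointwise on \<open>B\<close>.\<close>

lemma faithful_monomial_rep:
  fixes G :: "('g, 'h) monoid_scheme" and \<sigma> :: "'g \<Rightarrow> 'b \<Rightarrow> 'b" and \<alpha> :: "'g \<Rightarrow> 'b \<Rightarrow> complex"
  assumes fin: "finite B"
    and \<sigma>: "\<And>g b. g \<in> carrier G \<Longrightarrow> b \<in> B \<Longrightarrow> \<sigma> g b \<in> B"
    and inj: "\<And>g. g \<in> carrier G \<Longrightarrow> inj_on (\<sigma> g) B"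
    and nz: "\<And>g b. g \<in> carrier G \<Longrightarrow> b \<in> B \<Longrightarrow> \<alpha> g b \<noteq> 0"
    and hom: "\<And>g h b. g \<in> carrier G \<Longrightarrow> h \<in> carrier G \<Longrightarrow> b \<in> B \<Longrightarrow>
        \<sigma> (g \<otimes>\<^bsub>G\<^esub> h) b = \<sigma> g (\<sigma> h b) \<and> \<alpha> (g \<otimes>\<^bsub>G\<^esub> h) b = \<alpha> g (\<sigma> h b) * \<alpha> h b"
    and sep: "\<And>g h. g \<in> carrier G \<Longrightarrow> h \<in> carrier G \<Longrightarrow>
        (\<And>b. b \<in> B \<Longrightarrow> \<sigma> g b = \<sigma> h b \<and> \<alpha> g b = \<alpha> h b) \<Longrightarrow> g = h"
  shows "\<exists>\<rho>. faithful_rep G (card B) \<rho>"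
proof -
  obtain en where en: "bij_betw en {..<card B} B"
    using ex_bij_betw_nat_finite[OF fin] by (auto simp: atLeast0LessThan)
  let ?\<rho> = "\<lambda>g. monomial_mat (card B) en (\<sigma> g) (\<alpha> g)"
  have "bij_betw (\<sigma> g) B B" if "g \<in> carrier G" for g
    using endo_inj_surj[OF fin _ inj[OF that]] inj[OF that] \<sigma>[OF that] by (auto simp: bij_betw_def)
  then have "invertible_mat (?\<rho> g)" if "g \<in> carrier G" for g
    using invertible_monomial_mat[OF en] nz that by blast
  moreover have "?\<rho> (g \<otimes>\<^bsub>G\<^esub> h) = ?\<rho> g * ?\<rho> h" if "g \<in> carrier G" "h \<in> carrier G" for g h
    using \<sigma> hom that by (subst monomial_mat_mult[OF en]) (auto intro!: monomial_mat_cong[OF en])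
  moreover have "inj_on ?\<rho> (carrier G)"
    by (intro inj_onI sep) (use monomial_mat_eqD[OF en] \<sigma> nz in blast)+
  ultimately show ?thesis
    unfolding faithful_rep_def by (intro exI[of _ ?\<rho>]) auto
qed

subsection \<open>Characters of finite abelian groups\<close>

lemma faithful_repD:
  assumes "faithful_rep G d \<rho>"
  shows "g \<in> carrier G \<Longrightarrow> \<rho> g \<in> carrier_mat d d"
    and "g \<in> carrier G \<Longrightarrow> h \<in> carrier G \<Longrightarrow> \<rho> (g \<otimes>\<^bsub>G\<^esub> h) = \<rho> g * \<rho> h"
    and "inj_on \<rho> (carrier G)"
    and "g \<in> carrier G \<Longrightarrow> invertible_mat (\<rho> g)"
  using assms by (auto simp: faithful_rep_def)

text \<open>Multiplicativity makes \<open>\<rho> \<one>\<close> idempotent, and an invertible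
  idempotent is the identity.\<close>

lemma (in group) faithful_rep_one:
  assumes \<rho>: "faithful_rep G d \<rho>"
  shows "\<rho> \<one> = 1\<^sub>m d"
proof -
  have c: "\<rho> \<one> \<in> carrier_mat d d" and sq: "\<rho> \<one> * \<rho> \<one> = \<rho> \<one>" and "invertible_mat (\<rho> \<one>)"
    using faithful_repD[OF \<rho>] by (auto simp flip: faithful_repD(2)[OF \<rho>])
  then obtain B where B: "\<rho> \<one> * B = 1\<^sub>m d" "B * \<rho> \<one> = 1\<^sub>m (dim_row B)"
    by (auto simp: invertible_mat_def inverts_mat_def)
  \<comment> \<open>\<open>invertible_mat\<close> does not fix the shape of the inverse; both
    dimensions are read off from the two products.\<close>
  have "dim_row B = d" "dim_col B = d"
    using arg_cong[OF B(1), of dim_col] arg_cong[OF B(2), of dim_col] c by auto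
  then have Bc: "B \<in> carrier_mat d d" by auto
  have "\<rho> \<one> = \<rho> \<one> * (\<rho> \<one> * B)" using c B by simp
  also have "\<dots> = 1\<^sub>m d"
    using assoc_mult_mat[OF c c Bc] sq B(1) by simp
  finally show ?thesis .
qed

lemma (in group) faithful_rep_pow:
  assumes \<rho>: "faithful_rep G d \<rho>" and g: "g \<in> carrier G"
  shows "\<rho> (g [^] (j :: nat)) = \<rho> g ^\<^sub>m j"
proof (induction j)
  case 0
  then show ?case using faithful_rep_one[OF \<rho>] faithful_repD(1)[OF \<rho> g] by simp
next
  case (Suc j)
  then show ?case using g faithful_repD(2)[OF \<rho>] by simp
qed

text \<open>By the pigeonhole principle two powers of \<open>x\<close> coincide.\<close>

lemma (in group) exists_pow_eq_one:
  assumes fin: "finite (carrier G)" and x: "x \<in> carrier G"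
  shows "\<exists>N>0. x [^] (N :: nat) = \<one>"
proof -
  have "finite (range (\<lambda>i :: nat. x [^] i))"
    by (rule finite_subset[OF _ fin]) (use x in auto)
  then have "\<not> inj (\<lambda>i :: nat. x [^] i)" using finite_imageD infinite_UNIV_nat by blast
  then obtain i j :: nat where ij: "i < j" "x [^] i = x [^] j"
    by (metis linorder_injI)
  have "x [^] i \<otimes> x [^] (j - i) = x [^] i \<otimes> \<one>"
    using nat_pow_mult[OF x, of i "j - i"] ij x by simp
  then have "x [^] (j - i) = \<one>" using x by (simp add: Units_l_cancel)
  then show ?thesis using ij by (intro exI[of _ "j - i"]) auto
qed

text \<open>Faithfulness makes \<open>\<rho> a\<close> differ from the identity, so the commuting
  matrices \<open>\<rho> g\<close> of finite order have a joint eigenvector on which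
  \<open>a\<close> acts nontrivially. Eigenvalues of a nonzero vector are unique, hence
  \<open>\<mu>\<close> is multiplicative.\<close>

lemma (in group) exists_abelian_weight:
  assumes fin: "finite (carrier G)" and \<rho>: "faithful_rep G d \<rho>"
    and A: "subgroup A G" and comm: "\<And>g h. g \<in> A \<Longrightarrow> h \<in> A \<Longrightarrow> g \<otimes> h = h \<otimes> g"
    and a: "a \<in> A" "a \<noteq> \<one>"
  shows "\<exists>v \<mu>. v \<in> carrier_vec d \<and> v \<noteq> 0\<^sub>v d \<and> (\<forall>g\<in>A. \<rho> g *\<^sub>v v = \<mu> g \<cdot>\<^sub>v v) \<and>
     \<mu> a \<noteq> 1 \<and> \<mu> \<one> = 1 \<and> (\<forall>g\<in>A. \<forall>h\<in>A. \<mu> (g \<otimes> h) = \<mu> g * \<mu> h)"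
proof -
  have Ac: "g \<in> carrier G" if "g \<in> A" for g using subgroup.mem_carrier[OF A that] .
  note car = faithful_repD(1)[OF \<rho> Ac]
  have 1: "\<rho> g * \<rho> h = \<rho> h * \<rho> g" if "g \<in> A" "h \<in> A" for g h
    using that comm Ac by (simp flip: faithful_repD(2)[OF \<rho>])
  have 2: "\<exists>N>0. \<rho> g ^\<^sub>m N = 1\<^sub>m d" if "g \<in> A" for g
    using exists_pow_eq_one[OF fin Ac[OF that]] faithful_rep_pow[OF \<rho> Ac[OF that]] faithful_rep_one[OF \<rho>]
    by metis
  have 3: "\<rho> a \<noteq> 1\<^sub>m d"
    using a Ac faithful_repD(3)[OF \<rho>] faithful_rep_one[OF \<rho>] by (metis inj_onD one_closed)
  have "finite (\<rho> ` A)" using fin Ac by (meson finite_imageI finite_subset subsetI)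
  then obtain v c0 where v: "v \<in> carrier_vec d" "v \<noteq> 0\<^sub>v d" "c0 \<noteq> 1" "\<rho> a *\<^sub>v v = c0 \<cdot>\<^sub>v v"
    "\<And>g. g \<in> A \<Longrightarrow> \<exists>c. \<rho> g *\<^sub>v v = c \<cdot>\<^sub>v v"
  proof -
    have "\<exists>v c0. v \<in> carrier_vec d \<and> v \<noteq> 0\<^sub>v d \<and> c0 \<noteq> 1 \<and> \<rho> a *\<^sub>v v = c0 \<cdot>\<^sub>v v \<and>
        (\<forall>M\<in>\<rho> ` A. \<exists>c. M *\<^sub>v v = c \<cdot>\<^sub>v v)"
      using \<open>finite (\<rho> ` A)\<close> car 1 2 3 a(1) by (intro exists_joint_eigenvector) auto
    then show thesis using that by auto
  qed
  have uniq: "c = c'" if "c \<cdot>\<^sub>v v = c' \<cdot>\<^sub>v v" for c c'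
  proof -
    obtain i where i: "i < d" "v $ i \<noteq> 0" using v(1,2) by (auto simp: vec_eq_iff)
    have "(c \<cdot>\<^sub>v v) $ i = (c' \<cdot>\<^sub>v v) $ i" using that by simp
    then show ?thesis using i v(1) by simp
  qed
  obtain \<mu> where \<mu>: "\<And>g. g \<in> A \<Longrightarrow> \<rho> g *\<^sub>v v = \<mu> g \<cdot>\<^sub>v v" using v(5) by metis
  have "\<mu> (g \<otimes> h) = \<mu> g * \<mu> h" if gh: "g \<in> A" "h \<in> A" for g h
  proof (rule uniq)
    have "\<mu> (g \<otimes> h) \<cdot>\<^sub>v v = \<rho> g *\<^sub>v (\<rho> h *\<^sub>v v)"
      using gh Ac v(1) car subgroup.m_closed[OF A]
      by (simp flip: \<mu> add: faithful_repD(2)[OF \<rho>] assoc_mult_mat_vec[of _ d d _ d])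
    also have "\<dots> = \<mu> h \<cdot>\<^sub>v (\<mu> g \<cdot>\<^sub>v v)"
      using gh v(1) car by (simp add: \<mu> mult_mat_vec[of _ d d])
    finally show "\<mu> (g \<otimes> h) \<cdot>\<^sub>v v = (\<mu> g * \<mu> h) \<cdot>\<^sub>v v"
      by (simp add: smult_smult_assoc mult.commute)
  qed
  moreover have "\<mu> \<one> = 1"
    using \<mu>[OF subgroup.one_closed[OF A]] v(1) faithful_rep_one[OF \<rho>] by (intro uniq) simp
  moreover have "\<mu> a \<noteq> 1" using uniq[of "\<mu> a" c0] \<mu>[OF a(1)] v(3,4) by auto
  ultimately show ?thesis using v(1,2) \<mu> by blast
qed

section \<open>Existence of characters, their kernels, and separation of subgroups\<close>

definition is_character :: "('g, 'h) monoid_scheme \<Rightarrow> ('g \<Rightarrow> complex) \<Rightarrow> bool" where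
  "is_character G \<psi> \<longleftrightarrow> \<psi> \<one>\<^bsub>G\<^esub> = 1 \<and>
     (\<forall>x\<in>carrier G. \<forall>y\<in>carrier G. \<psi> (x \<otimes>\<^bsub>G\<^esub> y) = \<psi> x * \<psi> y)"

lemma is_characterD:
  assumes "is_character G \<psi>"
  shows "\<psi> \<one>\<^bsub>G\<^esub> = 1" "x \<in> carrier G \<Longrightarrow> y \<in> carrier G \<Longrightarrow> \<psi> (x \<otimes>\<^bsub>G\<^esub> y) = \<psi> x * \<psi> y"
  using assms by (auto simp: is_character_def)

text \<open>The regular representation is faithful, and a weight of the whole abelian group in it is
  a character.\<close>

lemma (in comm_group) exists_character_ne_one:
  assumes fin: "finite (carrier G)" and a: "a \<in> carrier G" "a \<noteq> \<one>"
  shows "\<exists>\<psi>. is_character G \<psi> \<and> \<psi> a \<noteq> 1"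
proof -
  have "\<exists>\<rho>. faithful_rep G (card (carrier G)) \<rho>"
  proof (rule faithful_monomial_rep[where \<sigma> = "\<lambda>g b. g \<otimes> b" and \<alpha> = "\<lambda>_ _. 1"])
    show "g = h" if "g \<in> carrier G" "h \<in> carrier G"
      "\<And>b. b \<in> carrier G \<Longrightarrow> g \<otimes> b = h \<otimes> b \<and> (1::complex) = 1" for g h
      using that(3)[of \<one>] that(1,2) by simp
  qed (use fin in \<open>auto simp: m_assoc inj_on_def\<close>)
  then obtain \<rho> where "faithful_rep G (card (carrier G)) \<rho>" by blast
  from exists_abelian_weight[OF fin this subgroup_self _ a] show ?thesis
    by (auto simp: is_character_def m_comm)
qed

text \<open>Pull back a character of \<open>G Mod H\<close> that is nontrivial at the coset of
  \<open>a\<close>.\<close>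

lemma (in comm_group) exists_character_separating:
  assumes fin: "finite (carrier G)" and H: "subgroup H G" and a: "a \<in> carrier G" "a \<notin> H"
  shows "\<exists>\<psi>. is_character G \<psi> \<and> (\<forall>h\<in>H. \<psi> h = 1) \<and> \<psi> a \<noteq> 1"
proof -
  interpret Q: comm_group "G Mod H" by (rule abelian_FactGroup[OF H])
  have N: "H \<lhd> G" using H by (simp add: normal_iff_subgroup)
  have "finite (carrier (G Mod H))" using fin by (simp add: FactGroup_def RCOSETS_def)
  moreover have "H #> a \<in> carrier (G Mod H)" using a by (auto simp: FactGroup_def RCOSETS_def)
  moreover have "H #> a \<noteq> \<one>\<^bsub>G Mod H\<^esub>"
    using a rcos_self[OF a(1) H] by (auto simp: FactGroup_def)
  ultimately obtain \<psi> where \<psi>: "is_character (G Mod H) \<psi>" "\<psi> (H #> a) \<noteq> 1"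
    using Q.exists_character_ne_one by blast
  have "H #> h = H" if "h \<in> H" for h
    using that H by (simp add: coset_join2 subgroup.mem_carrier)
  then have "\<psi> (H #> h) = 1" if "h \<in> H" for h
    using that is_characterD(1)[OF \<psi>(1)] by (simp add: FactGroup_def)
  moreover have "\<psi> (H #> (x \<otimes> y)) = \<psi> (H #> x) * \<psi> (H #> y)"
    if "x \<in> carrier G" "y \<in> carrier G" for x y
    using that is_characterD(2)[OF \<psi>(1), of "H #> x" "H #> y"] normal.rcos_sum[OF N that]
    by (auto simp: FactGroup_def RCOSETS_def)
  ultimately show ?thesis
    using \<psi>(2) subgroup.one_closed[OF H]
    by (intro exI[of _ "\<lambda>x. \<psi> (H #> x)"]) (auto simp: is_character_def)
qed

lemma (in comm_group) is_character_pow: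
  assumes "is_character G \<psi>" "x \<in> carrier G"
  shows "\<psi> (x [^] (j::nat)) = \<psi> x ^ j"
  by (induction j) (use assms in \<open>auto simp: is_character_def\<close>)

lemma (in comm_group) is_character_inv:
  assumes "is_character G \<psi>" "x \<in> carrier G"
  shows "\<psi> (inv x) * \<psi> x = 1"
  using is_characterD[OF assms(1)] assms(2) by (metis inv_closed l_inv)

lemma (in comm_group) subgroup_character_kernel:
  assumes "subgroup E G" and \<psi>: "is_character G \<psi>"
  shows "subgroup {x \<in> E. \<psi> x = 1} G"
proof -
  interpret E: subgroup E G by fact
  show ?thesis
  proof (rule subgroupI)
    fix x assume "x \<in> {x \<in> E. \<psi> x = 1}"
    then show "inv x \<in> {x \<in> E. \<psi> x = 1}"
      using is_character_inv[OF \<psi>, of x] E.mem_carrier by auto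
  next
    show "{x \<in> E. \<psi> x = 1} \<noteq> {}" using E.one_closed is_characterD(1)[OF \<psi>] by blast
  qed (use is_characterD[OF \<psi>] E.mem_carrier in auto)
qed

text \<open>If a power with exponent strictly between 0 and \<open>p\<close> were 1, Bezout would
  give \<open>\<zeta> = 1\<close>; so \<open>\<zeta>\<close> has order exactly
  \<open>p\<close>.\<close>

lemma root_of_unity_prime_power_inj:
  fixes \<zeta> :: complex
  assumes p: "prime p" and \<zeta>: "\<zeta> ^ p = 1" "\<zeta> \<noteq> 1"
  shows "inj_on (\<lambda>i. \<zeta> ^ i) {..<p}"
proof -
  have \<zeta>0: "\<zeta> \<noteq> 0" using \<zeta> p by (metis power_0_left prime_gt_0_nat less_irrefl zero_neq_one)
  have ne: "\<zeta> ^ i \<noteq> 1" if i: "0 < i" "i < p" for i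
  proof
    assume 1: "\<zeta> ^ i = 1"
    have "coprime i p" using i p by (metis coprime_commute nat_dvd_not_less prime_imp_coprime_nat)
    then obtain x y where xy: "i * x = p * y + 1"
      using i by (metis bezout_nat coprime_imp_gcd_eq_1 not_less0)
    have "\<zeta> ^ (i * x) = 1" using 1 by (simp add: power_mult)
    moreover have "\<zeta> ^ (p * y + 1) = \<zeta>" using \<zeta> by (simp add: power_mult)
    ultimately show False using xy \<zeta> by simp
  qed
  show ?thesis
  proof (rule linorder_inj_onI)
    fix i j assume "i < j" "i \<in> {..<p}" "j \<in> {..<p}"
    then have "\<zeta> ^ j = \<zeta> ^ i * \<zeta> ^ (j - i)" "\<zeta> ^ (j - i) \<noteq> 1"
      using ne[of "j - i"] by (auto simp flip: power_add)
    then show "\<zeta> ^ i \<noteq> \<zeta> ^ j" using \<zeta>0 by auto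
  qed auto
qed

text \<open>\<open>\<chi> a\<close> generates the group of \<open>p\<close>-th roots of unity, so
  the powers \<open>a [^] i\<close> with \<open>i < p\<close> represent the cosets of the kernel of
  \<open>\<chi>\<close> in \<open>E\<close>.\<close>

lemma (in comm_group) card_character_kernel:
  assumes "subgroup E G" and p: "prime p" and \<chi>: "is_character G \<chi>"
    and \<chi>p: "\<And>x. x \<in> E \<Longrightarrow> \<chi> x ^ p = 1" and a: "a \<in> E" "\<chi> a \<noteq> 1"
  shows "card E = p * card {x \<in> E. \<chi> x = 1}"
proof -
  interpret E: subgroup E G by fact
  let ?K = "{x \<in> E. \<chi> x = 1}"
  have pwE: "a [^] (i::nat) \<in> E" for i by (induction i) (use a in auto)
  have \<chi>pw: "\<chi> (a [^] l \<otimes> b) = \<chi> a ^ l * \<chi> b" if "b \<in> E" for b and l :: nat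
    using that pwE[of l] a(1) is_characterD(2)[OF \<chi>, of "a [^] l" b] by (simp add: is_character_pow[OF \<chi>])
  note inj = root_of_unity_prime_power_inj[OF p \<chi>p[OF a(1)] a(2)]
  have "bij_betw (\<lambda>(i, x). a [^] (i::nat) \<otimes> x) ({..<p} \<times> ?K) E"
  proof (intro bij_betw_imageI)
    show "inj_on (\<lambda>(i, x). a [^] (i::nat) \<otimes> x) ({..<p} \<times> ?K)"
    proof (rule inj_onI, clarsimp)
      fix i x and i' :: nat and x'
      assume *: "a [^] i \<otimes> x = a [^] i' \<otimes> x'" "i < p" "i' < p" "x \<in> E" "x' \<in> E" "\<chi> x = 1" "\<chi> x' = 1"
      have "\<chi> a ^ i = \<chi> a ^ i'" using \<chi>pw[OF *(4), of i] \<chi>pw[OF *(5), of i'] * by simp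
      then have "i = i'" using *(2,3) inj by (auto dest: inj_onD)
      then show "i = i' \<and> x = x'" using * a(1) by simp
    qed
    show "(\<lambda>(i, x). a [^] (i::nat) \<otimes> x) ` ({..<p} \<times> ?K) = E"
    proof (intro equalityI subsetI)
      fix x assume x: "x \<in> E"
      \<comment> \<open>The powers of \<open>\<chi> a\<close> are \<open>p\<close> distinct
        \<open>p\<close>-th roots of unity, hence all of them.\<close>
      have "(\<lambda>i. \<chi> a ^ i) ` {..<p} = {z. z ^ p = 1}"
      proof (rule card_subset_eq)
        show "(\<lambda>i. \<chi> a ^ i) ` {..<p} \<subseteq> {z. z ^ p = 1}"
          using \<chi>p[OF a(1)] by (auto simp flip: power_mult) (metis mult.commute power_mult power_one)
        show "card ((\<lambda>i. \<chi> a ^ i) ` {..<p}) = card {z::complex. z ^ p = 1}"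
          using card_image[OF inj] prime_gt_0_nat[OF p] by (simp add: card_roots_unity_eq)
      qed (use prime_gt_0_nat[OF p] in \<open>auto intro!: finite_roots_unity\<close>)
      then obtain i where i: "i < p" "\<chi> x = \<chi> a ^ i" using \<chi>p[OF x] by blast
      let ?y = "inv (a [^] i) \<otimes> x"
      have y: "?y \<in> E" "a [^] i \<otimes> ?y = x"
        using x pwE[of i] E.mem_carrier by (auto simp flip: m_assoc)
      have "\<chi> x \<noteq> 0" using is_character_inv[OF \<chi>, of x] E.mem_carrier[OF x] by auto
      moreover have "\<chi> x = \<chi> x * \<chi> ?y"
        using \<chi>pw[OF y(1), of i] unfolding y(2) i(2)[symmetric] .
      ultimately have "\<chi> ?y = 1" by (metis mult_cancel_left1)
      then show "x \<in> (\<lambda>(i, x). a [^] (i::nat) \<otimes> x) ` ({..<p} \<times> ?K)"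
        using y i(1) by (intro image_eqI[where x = "(i, ?y)"]) auto
    qed (use pwE in auto)
  qed
  from bij_betw_same_card[OF this] show ?thesis by (simp add: card_cartesian_product)
qed

text \<open>Induction along kernels: a character nontrivial on \<open>E\<close> has a kernel of
  index \<open>p\<close> in \<open>E\<close>. For the residue field this shows that its order is a
  power of \<open>p\<close>.\<close>

lemma (in comm_group) card_elementary_abelian:
  assumes fin: "finite (carrier G)" and p: "prime p" and "subgroup E G" "\<And>x. x \<in> E \<Longrightarrow> x [^] p = \<one>"
  shows "\<exists>j. card E = p ^ j"
  using assms(3,4)
proof (induction "card E" arbitrary: E rule: less_induct)
  case less
  interpret E: subgroup E G by fact
  have finE: "finite E" using fin by (meson finite_subset E.subset)
  show ?case
  proof (cases "E = {\<one>}")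
    case True
    then show ?thesis by (intro exI[of _ 0]) simp
  next
    case False
    then obtain a where a: "a \<in> E" "a \<noteq> \<one>" using E.one_closed by blast
    obtain \<chi> where \<chi>: "is_character G \<chi>" "\<chi> a \<noteq> 1"
      using exists_character_ne_one[OF fin E.mem_carrier[OF a(1)] a(2)] by blast
    let ?K = "{x \<in> E. \<chi> x = 1}"
    have "\<chi> x ^ p = 1" if "x \<in> E" for x
      using less.prems(2)[OF that] is_character_pow[OF \<chi>(1), of x p] that is_characterD(1)[OF \<chi>(1)] by simp
    then have card: "card E = p * card ?K" using card_character_kernel less.prems(1) p \<chi> a(1) by blast
    have "card ?K < card E" using finE a(1) \<chi>(2) by (intro psubset_card_mono) auto
    then obtain j where "card ?K = p ^ j"
      using less.hyps[OF _ subgroup_character_kernel[OF less.prems(1) \<chi>(1)]] less.prems(2) by blast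
    then show ?thesis using card by (intro exI[of _ "Suc j"]) simp
  qed
qed

text \<open>Each new character is trivial on \<open>H\<close> and cuts \<open>E\<close> down by a
  factor \<open>p\<close>. After \<open>j\<close> of them the common kernel contains
  \<open>H\<close> and has at most \<open>card H\<close> elements, so it is
  \<open>H\<close>.\<close>

lemma (in comm_group) exists_separating_characters:
  assumes fin: "finite (carrier G)" and p: "prime p" and H: "subgroup H G"
    and "subgroup E G" "H \<subseteq> E" "\<And>x. x \<in> E \<Longrightarrow> x [^] p \<in> H" "card E \<le> p ^ j * card H"
  shows "\<exists>\<psi>. (\<forall>i<j. is_character G (\<psi> i) \<and> (\<forall>h\<in>H. \<psi> i h = 1)) \<and>
              (\<forall>x\<in>E. (\<forall>i<j. \<psi> i x = 1) \<longrightarrow> x \<in> H)"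
  using assms(4-)
proof (induction j arbitrary: E)
  case 0
  have "finite E" using fin 0(1) by (meson finite_subset subgroup.subset)
  then have "E = H" using 0(2,4) card_seteq[of E H] by simp
  then show ?case by auto
next
  case (Suc j)
  interpret E: subgroup E G by fact
  have finE: "finite E" using fin by (meson finite_subset E.subset)
  show ?case
  proof (cases "E = H")
    case True
    \<comment> \<open>\<open>H\<close> is already reached; trivial characters fill the remaining
      places.\<close>
    then show ?thesis by (intro exI[of _ "\<lambda>_ _. 1"]) (auto simp: is_character_def)
  next
    case False
    then obtain a where a: "a \<in> E" "a \<notin> H" using Suc.prems(2) by blast
    obtain \<chi> where \<chi>: "is_character G \<chi>" "\<And>h. h \<in> H \<Longrightarrow> \<chi> h = 1" "\<chi> a \<noteq> 1"
      using exists_character_separating[OF fin H E.mem_carrier[OF a(1)] a(2)] by auto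
    define E' where "E' = {x \<in> E. \<chi> x = 1}"
    have E': "subgroup E' G" unfolding E'_def by (rule subgroup_character_kernel) fact+
    have \<chi>pw: "\<chi> x ^ p = 1" if "x \<in> E" for x
      using \<chi>(2)[OF Suc.prems(3)[OF that]] is_character_pow[OF \<chi>(1), of x p] that by simp
    have "p * card E' = card E"
      unfolding E'_def using card_character_kernel[OF Suc.prems(1) p \<chi>(1) \<chi>pw a(1) \<chi>(3)] by simp
    then have "p * card E' \<le> p * (p ^ j * card H)"
      using Suc.prems(4) by (simp add: mult.assoc del: nat_mult_le_cancel_disj)
    then have "card E' \<le> p ^ j * card H" using prime_gt_0_nat[OF p] by simp
    moreover have "H \<subseteq> E'" using Suc.prems(2) \<chi>(2) by (auto simp: E'_def)
    ultimately obtain \<psi> where \<psi>: "\<forall>i<j. is_character G (\<psi> i) \<and> (\<forall>h\<in>H. \<psi> i h = 1)"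
      "\<forall>x\<in>E'. (\<forall>i<j. \<psi> i x = 1) \<longrightarrow> x \<in> H"
      using Suc.IH[OF E'] Suc.prems(3) by (auto simp: E'_def)
    show ?thesis
    proof (intro exI[of _ "\<psi>(j := \<chi>)"] conjI ballI impI allI)
      fix x assume "x \<in> E" "\<forall>i<Suc j. (\<psi>(j := \<chi>)) i x = 1"
      then have "x \<in> E'" "\<forall>i<j. \<psi> i x = 1"
        by (auto simp: E'_def less_Suc_eq split: if_splits)
      then show "x \<in> H" using \<psi>(2) by blast
    qed (use \<psi>(1) \<chi> in \<open>auto simp: less_Suc_eq\<close>)
  qed
qed

subsection \<open>The Heisenberg group over a commutative ring\<close>

context cring
begin

definition vecs :: "nat \<Rightarrow> 'a list set" where
  "vecs k = {x. length x = k \<and> set x \<subseteq> carrier R}"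

definition dot :: "nat \<Rightarrow> 'a list \<Rightarrow> 'a list \<Rightarrow> 'a" where
  "dot k x y = (\<Oplus>i\<in>{..<k}. x ! i \<otimes> y ! i)"

abbreviation vadd :: "'a list \<Rightarrow> 'a list \<Rightarrow> 'a list" where
  "vadd \<equiv> map2 (\<oplus>)"

lemma vecs_length [simp]: "x \<in> vecs k \<Longrightarrow> length x = k"
  by (simp add: vecs_def)

lemma vecs_nth [simp]: "x \<in> vecs k \<Longrightarrow> i < k \<Longrightarrow> x ! i \<in> carrier R"
  unfolding vecs_def using nth_mem by blast

lemma vecsI: "length x = k \<Longrightarrow> (\<And>i. i < k \<Longrightarrow> x ! i \<in> carrier R) \<Longrightarrow> x \<in> vecs k"
  unfolding vecs_def by (metis (mono_tags, lifting) in_set_conv_nth mem_Collect_eq subsetI)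

lemma vecs_eqI:
  assumes "x \<in> vecs k" "y \<in> vecs k" "\<And>i. i < k \<Longrightarrow> x ! i = y ! i"
  shows "x = y"
  using assms by (auto intro: nth_equalityI)

lemma vadd_closed [simp]: "x \<in> vecs k \<Longrightarrow> y \<in> vecs k \<Longrightarrow> vadd x y \<in> vecs k"
  by (auto intro!: vecsI)

lemma vzero_closed [simp]: "replicate k \<zero> \<in> vecs k"
  by (auto intro: vecsI)

lemma vneg_closed [simp]: "x \<in> vecs k \<Longrightarrow> map (a_inv R) x \<in> vecs k"
  by (auto intro!: vecsI)

lemma dot_closed [simp]: "x \<in> vecs k \<Longrightarrow> y \<in> vecs k \<Longrightarrow> dot k x y \<in> carrier R"
  by (auto simp: dot_def intro!: finsum_closed)

lemma dot_vadd_left: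
  assumes "x \<in> vecs k" "x' \<in> vecs k" "y \<in> vecs k"
  shows "dot k (vadd x x') y = dot k x y \<oplus> dot k x' y"
proof -
  have "dot k (vadd x x') y = (\<Oplus>i\<in>{..<k}. x ! i \<otimes> y ! i \<oplus> x' ! i \<otimes> y ! i)"
    unfolding dot_def using assms by (intro finsum_cong') (auto simp: l_distr)
  then show ?thesis
    unfolding dot_def using assms by (simp add: finsum_addf Pi_def)
qed

lemma dot_vadd_right:
  assumes "x \<in> vecs k" "y \<in> vecs k" "y' \<in> vecs k"
  shows "dot k x (vadd y y') = dot k x y \<oplus> dot k x y'"
proof -
  have "dot k x (vadd y y') = (\<Oplus>i\<in>{..<k}. x ! i \<otimes> y ! i \<oplus> x ! i \<otimes> y' ! i)"
    unfolding dot_def using assms by (intro finsum_cong') (auto simp: r_distr)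
  then show ?thesis
    unfolding dot_def using assms by (simp add: finsum_addf Pi_def)
qed

lemma dot_vzero_left [simp]: "y \<in> vecs k \<Longrightarrow> dot k (replicate k \<zero>) y = \<zero>"
  unfolding dot_def by (intro add.finprod_one_eqI) auto

lemma dot_vzero_right [simp]: "x \<in> vecs k \<Longrightarrow> dot k x (replicate k \<zero>) = \<zero>"
  unfolding dot_def by (intro add.finprod_one_eqI) auto

lemma Hei_carrier: "carrier (Hei k R) = vecs k \<times> vecs k \<times> carrier R"
  by (auto simp: Hei_def vecs_def simp del: vecs_length)

lemma Hei_mult:
  "(x, y, z) \<otimes>\<^bsub>Hei k R\<^esub> (x', y', z') = (vadd x x', vadd y y', z \<oplus> z' \<oplus> dot k x y')"
  by (simp add: Hei_def dot_def)

lemma Hei_one: "\<one>\<^bsub>Hei k R\<^esub> = (replicate k \<zero>, replicate k \<zero>, \<zero>)"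
  by (simp add: Hei_def)

lemma vadd_assoc:
  "x \<in> vecs k \<Longrightarrow> y \<in> vecs k \<Longrightarrow> z \<in> vecs k \<Longrightarrow> vadd (vadd x y) z = vadd x (vadd y z)"
  by (intro vecs_eqI[of _ k]) (auto simp: a_assoc)

lemma vadd_comm: "x \<in> vecs k \<Longrightarrow> y \<in> vecs k \<Longrightarrow> vadd x y = vadd y x"
  by (intro vecs_eqI[of _ k]) (auto simp: a_comm)

lemma vadd_vzero_left [simp]: "x \<in> vecs k \<Longrightarrow> vadd (replicate k \<zero>) x = x"
  by (intro vecs_eqI[of _ k]) auto

lemma vadd_vzero_right [simp]: "x \<in> vecs k \<Longrightarrow> vadd x (replicate k \<zero>) = x"
  by (intro vecs_eqI[of _ k]) auto

lemma vadd_vneg_left [simp]: "x \<in> vecs k \<Longrightarrow> vadd (map (a_inv R) x) x = replicate k \<zero>"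
  by (intro vecs_eqI[of _ k]) (auto simp: l_neg)

lemma group_Hei: "group (Hei k R)"
proof (rule groupI)
  fix g h l assume "g \<in> carrier (Hei k R)" "h \<in> carrier (Hei k R)" "l \<in> carrier (Hei k R)"
  then show "g \<otimes>\<^bsub>Hei k R\<^esub> h \<otimes>\<^bsub>Hei k R\<^esub> l = g \<otimes>\<^bsub>Hei k R\<^esub> (h \<otimes>\<^bsub>Hei k R\<^esub> l)"
    by (auto simp: Hei_carrier Hei_mult vadd_assoc dot_vadd_left dot_vadd_right a_ac)
next
  fix g assume "g \<in> carrier (Hei k R)"
  then obtain x y z where g: "g = (x, y, z)" "x \<in> vecs k" "y \<in> vecs k" "z \<in> carrier R"
    by (auto simp: Hei_carrier)
  let ?x = "map (a_inv R) x"
  \<comment> \<open>The third entry of the left inverse also has to cancel the inner product that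
    the multiplication adds.\<close>
  show "\<exists>h\<in>carrier (Hei k R). h \<otimes>\<^bsub>Hei k R\<^esub> g = \<one>\<^bsub>Hei k R\<^esub>"
    using g
    by (intro bexI[of _ "(?x, map (a_inv R) y, \<ominus> z \<oplus> \<ominus> dot k ?x y)"])
      (auto simp: Hei_carrier Hei_mult Hei_one a_assoc l_neg r_neg a_comm[of _ "dot k ?x y"] r_neg1 r_neg2
        a_lcomm)
qed (auto simp: Hei_carrier Hei_mult Hei_one)

lemma finite_Hei: "finite (carrier R) \<Longrightarrow> finite (carrier (Hei k R))"
  using finite_lists_length_eq[of "carrier R" k]
  by (simp add: Hei_carrier vecs_def conj_commute del: vecs_length)

section \<open>Characters of the additive group of the ring\<close>

definition add_char :: "('a \<Rightarrow> complex) \<Rightarrow> bool" where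
  "add_char \<psi> \<longleftrightarrow> is_character (add_monoid R) \<psi>"

lemma add_char_zero: "add_char \<psi> \<Longrightarrow> \<psi> \<zero> = 1"
  by (auto simp: add_char_def is_character_def)

lemma add_char_add:
  "add_char \<psi> \<Longrightarrow> x \<in> carrier R \<Longrightarrow> y \<in> carrier R \<Longrightarrow> \<psi> (x \<oplus> y) = \<psi> x * \<psi> y"
  by (auto simp: add_char_def is_character_def)

lemma add_char_nonzero:
  assumes "add_char \<psi>" "x \<in> carrier R"
  shows "\<psi> x \<noteq> 0"
  using add_char_add[OF assms(1), of x "\<ominus> x"] add_char_zero[OF assms(1)] assms(2)
  by (auto simp: r_neg)

lemma add_char_minus:
  assumes "add_char \<psi>" "x \<in> carrier R" "y \<in> carrier R"
  shows "\<psi> (x \<ominus> y) = \<psi> x / \<psi> y"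
proof -
  have "\<psi> x = \<psi> (x \<ominus> y) * \<psi> y"
    using assms add_char_add[OF assms(1), of "x \<ominus> y" y] by (simp add: minus_eq a_assoc l_neg)
  then show ?thesis using add_char_nonzero[OF assms(1,3)] by simp
qed

lemma add_char_finsum:
  assumes "add_char \<psi>" "finite S" "\<And>i. i \<in> S \<Longrightarrow> g i \<in> carrier R"
  shows "\<psi> (finsum R g S) = (\<Prod>i\<in>S. \<psi> (g i))"
  using assms(2,3)
  by (induction S rule: finite_induct) (auto simp: add_char_zero add_char_add assms(1) Pi_def)

lemma add_char_add_pow:
  assumes "add_char \<psi>" "x \<in> carrier R"
  shows "\<psi> ([(j::nat)] \<cdot> x) = \<psi> x ^ j"
  by (induction j) (use assms in \<open>auto simp: add_char_zero add_char_add\<close>)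

lemma add_char_dot:
  assumes "add_char \<psi>" "x \<in> vecs k" "y \<in> vecs k"
  shows "\<psi> (dot k x y) = (\<Prod>i<k. \<psi> (x ! i \<otimes> y ! i))"
  unfolding dot_def using assms by (intro add_char_finsum) auto

subsection \<open>Coset representatives\<close>

text \<open>Elements of \<open>R / I\<close> are handled through chosen representatives, so that
  \<open>(R / I)^k\<close> becomes a set of lists over \<open>R\<close> with which
  \<open>dot\<close> can be formed directly.\<close>

definition coset_rep :: "'a set \<Rightarrow> 'a \<Rightarrow> 'a" where
  "coset_rep I x = (SOME y. y \<in> carrier R \<and> y \<ominus> x \<in> I)"

context
  fixes I assumes I: "ideal I R"
begin

lemma coset_rep:
  assumes "x \<in> carrier R"
  shows "coset_rep I x \<in> carrier R" "coset_rep I x \<ominus> x \<in> I"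
proof -
  have "x \<in> carrier R \<and> x \<ominus> x \<in> I"
    using assms I by (simp add: minus_eq r_neg additive_subgroup.zero_closed ideal.axioms(1))
  from someI[where P = "\<lambda>y. y \<in> carrier R \<and> y \<ominus> x \<in> I", OF this]
  show "coset_rep I x \<in> carrier R" "coset_rep I x \<ominus> x \<in> I"
    by (auto simp: coset_rep_def)
qed

lemma ideal_minus_sym:
  assumes "x \<in> carrier R" "y \<in> carrier R" "x \<ominus> y \<in> I"
  shows "y \<ominus> x \<in> I"
proof -
  have "\<ominus> (x \<ominus> y) \<in> I"
    using assms I by (simp add: additive_subgroup.a_inv_closed ideal.axioms(1))
  then show ?thesis using assms by (simp add: minus_eq minus_add a_comm)
qed

lemma ideal_minus_trans:
  assumes "x \<in> carrier R" "y \<in> carrier R" "z \<in> carrier R" "x \<ominus> y \<in> I" "y \<ominus> z \<in> I"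
  shows "x \<ominus> z \<in> I"
proof -
  have "(x \<ominus> y) \<oplus> (y \<ominus> z) \<in> I"
    using assms I by (simp add: additive_subgroup.a_closed ideal.axioms(1))
  then show ?thesis using assms by (simp add: minus_eq a_assoc r_neg1)
qed

text \<open>Congruent elements have the same candidates for a representative, so the choice operator
  returns the same one.\<close>

lemma coset_rep_eq_iff:
  assumes "x \<in> carrier R" "y \<in> carrier R"
  shows "coset_rep I x = coset_rep I y \<longleftrightarrow> x \<ominus> y \<in> I"
proof
  assume "coset_rep I x = coset_rep I y"
  then show "x \<ominus> y \<in> I"
    using coset_rep[OF assms(1)] coset_rep[OF assms(2)] assms ideal_minus_sym ideal_minus_trans by metis
next
  assume "x \<ominus> y \<in> I"
  then have "z \<ominus> x \<in> I \<longleftrightarrow> z \<ominus> y \<in> I" if "z \<in> carrier R" for z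
    using that assms ideal_minus_sym ideal_minus_trans by metis
  then have "(\<lambda>z. z \<in> carrier R \<and> z \<ominus> x \<in> I) = (\<lambda>z. z \<in> carrier R \<and> z \<ominus> y \<in> I)" by auto
  then show "coset_rep I x = coset_rep I y" unfolding coset_rep_def by simp
qed

lemma coset_rep_idem: "x \<in> carrier R \<Longrightarrow> coset_rep I (coset_rep I x) = coset_rep I x"
  using coset_rep coset_rep_eq_iff by blast

text \<open>Intermediate reductions do not matter, which makes translation of representatives a
  group action.\<close>

lemma coset_rep_add_cong:
  assumes "x \<in> carrier R" "y \<in> carrier R"
  shows "coset_rep I (x \<oplus> coset_rep I y) = coset_rep I (x \<oplus> y)"
proof -
  have "x \<oplus> coset_rep I y \<ominus> (x \<oplus> y) = coset_rep I y \<ominus> y"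
    using assms coset_rep[OF assms(2)] by algebra
  then show ?thesis using assms coset_rep by (subst coset_rep_eq_iff) auto
qed

text \<open>As in Lagrange's theorem, each ring element is uniquely the sum of a representative and
  an element of \<open>I\<close>.\<close>

lemma card_coset_reps: "card (coset_rep I ` carrier R) * card I = card (carrier R)"
proof -
  have IR: "I \<subseteq> carrier R" using I by (simp add: additive_subgroup.a_subset ideal.axioms(1))
  have "bij_betw (\<lambda>(r, i). r \<oplus> i) (coset_rep I ` carrier R \<times> I) (carrier R)"
  proof (intro bij_betw_imageI)
    show "inj_on (\<lambda>(r, i). r \<oplus> i) (coset_rep I ` carrier R \<times> I)"
    proof (rule inj_onI, clarsimp)
      fix x i x' i' assume *: "x \<in> carrier R" "x' \<in> carrier R" "i \<in> I" "i' \<in> I"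
        "coset_rep I x \<oplus> i = coset_rep I x' \<oplus> i'"
      have car: "i \<in> carrier R" "i' \<in> carrier R" "coset_rep I x \<in> carrier R" "coset_rep I x' \<in> carrier R"
        using * IR coset_rep by auto
      have rep: "coset_rep I (coset_rep I y \<oplus> j) = coset_rep I y" if "y \<in> carrier R" "j \<in> I" for y j
      proof -
        have j: "j \<in> carrier R" using that IR by auto
        have "coset_rep I y \<oplus> j \<ominus> coset_rep I y = j"
          using j coset_rep(1)[OF that(1)] by algebra
        then have "coset_rep I (coset_rep I y \<oplus> j) = coset_rep I (coset_rep I y)"
          using that j coset_rep by (subst coset_rep_eq_iff) auto
        then show ?thesis using coset_rep_idem that by simp
      qed
      have "coset_rep I x = coset_rep I x'" using rep * by metis
      then show "coset_rep I x = coset_rep I x' \<and> i = i'" using * car by auto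
    qed
    show "(\<lambda>(r, i). r \<oplus> i) ` (coset_rep I ` carrier R \<times> I) = carrier R"
    proof (intro equalityI subsetI)
      fix x assume x: "x \<in> carrier R"
      have "x \<ominus> coset_rep I x \<in> I" using x coset_rep ideal_minus_sym by blast
      moreover have "x = coset_rep I x \<oplus> (x \<ominus> coset_rep I x)"
        using x coset_rep(1)[OF x] by algebra
      ultimately show "x \<in> (\<lambda>(r, i). r \<oplus> i) ` (coset_rep I ` carrier R \<times> I)"
        using x by (intro image_eqI[where x = "(coset_rep I x, x \<ominus> coset_rep I x)"]) auto
    qed (use IR coset_rep in auto)
  qed
  from bij_betw_same_card[OF this] show ?thesis by (simp add: card_cartesian_product)
qed

end

end

subsection \<open>Finite chain rings\<close>

lemma (in cring) minus_eq_zeroD: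
  assumes "x \<in> carrier R" "y \<in> carrier R" "x \<ominus> y = \<zero>"
  shows "x = y"
proof -
  have "x = (x \<ominus> y) \<oplus> y" using assms(1,2) by algebra
  then show ?thesis using assms by simp
qed

text \<open>Collects what both bounds use of the quotient ring and its chain of ideals. In
  \<open>J_multiple\<close>, an element outside \<open>J (Suc m)\<close> has valuation at most
  \<open>m\<close> and so divides all of \<open>J m\<close>; \<open>p_torsion\<close> encodes the
  truncated ramification index.\<close>

locale finite_chain_ring = cring R for R (structure) +
  fixes J :: "nat \<Rightarrow> 'a set" and p f n \<xi> :: nat
  assumes prime_p: "prime p" and f_pos: "0 < f" and \<xi>_pos: "0 < \<xi>" and \<xi>_le: "\<xi> \<le> n"
    and finite_carrier: "finite (carrier R)"
    and ideal_J: "ideal (J i) R"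
    and J_0: "J 0 = carrier R" and J_n: "J n = {\<zero>}"
    and J_Suc: "J (Suc i) \<subseteq> J i"
    and card_J: "i \<le> n \<Longrightarrow> card (J i) = (p ^ f) ^ (n - i)"
    and J_multiple: "y \<in> carrier R \<Longrightarrow> y \<notin> J (Suc m) \<Longrightarrow> x \<in> J m \<Longrightarrow> \<exists>r\<in>carrier R. x = r \<otimes> y"
    and p_torsion: "x \<in> carrier R \<Longrightarrow> [p] \<cdot> x = \<zero> \<longleftrightarrow> x \<in> J (n - \<xi>)"
    and p_mult_J: "x \<in> J i \<Longrightarrow> [p] \<cdot> x \<in> J (Suc i)"
begin

lemma J_antimono: "i \<le> j \<Longrightarrow> J j \<subseteq> J i"
  by (rule lift_Suc_antimono_le[of J]) (use J_Suc in auto)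

lemma J_subset: "J i \<subseteq> carrier R"
  using J_antimono[of 0 i] J_0 by simp

lemma J_closed_mult: "x \<in> carrier R \<Longrightarrow> y \<in> J i \<Longrightarrow> x \<otimes> y \<in> J i"
  using ideal_J by (simp add: ideal.I_l_closed)

lemma subgroup_J: "subgroup (J i) (add_monoid R)"
  using ideal_J by (simp add: additive_subgroup.a_subgroup ideal.axioms(1))

lemma J_minus: "x \<in> J i \<Longrightarrow> y \<in> J i \<Longrightarrow> x \<ominus> y \<in> J i"
  using subgroup_J[of i] J_subset[of i] by (auto simp: minus_eq subgroup_def a_inv_def)

text \<open>One list for each element of \<open>(R / J m)^k\<close>.\<close>

definition reps :: "nat \<Rightarrow> nat \<Rightarrow> 'a list set" where
  "reps k m = {t. set t \<subseteq> coset_rep (J m) ` carrier R \<and> length t = k}"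

lemma finite_reps: "finite (reps k m)"
  unfolding reps_def using finite_carrier by (simp add: finite_lists_length_eq)

lemma card_reps: assumes "m \<le> n" shows "card (reps k m) = (p ^ f) ^ (k * m)"
proof -
  have "card (coset_rep (J m) ` carrier R) * (p ^ f) ^ (n - m) = (p ^ f) ^ m * (p ^ f) ^ (n - m)"
    using card_coset_reps[OF ideal_J[of m]] card_J[OF assms] card_J[of 0] J_0 assms
    by (simp flip: power_add)
  then have "card (coset_rep (J m) ` carrier R) = (p ^ f) ^ m"
    using prime_gt_0_nat[OF prime_p] by auto
  then show ?thesis
    unfolding reps_def using finite_carrier
    by (simp add: card_lists_length_eq power_mult[symmetric] mult.commute mult.left_commute)
qed

lemma reps_vecs: "reps k m \<subseteq> vecs k"
  using coset_rep(1)[OF ideal_J] by (auto simp: reps_def vecs_def simp del: vecs_length)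

lemma repsI: "length t = k \<Longrightarrow> (\<And>i. i < k \<Longrightarrow> t ! i \<in> coset_rep (J m) ` carrier R) \<Longrightarrow> t \<in> reps k m"
  by (auto simp: reps_def in_set_conv_nth)

lemma reps_nth:
  assumes "t \<in> reps k m" "i < k"
  shows "coset_rep (J m) (t ! i) = t ! i"
proof -
  have "t ! i \<in> coset_rep (J m) ` carrier R"
    using assms nth_mem[of i t] unfolding reps_def by blast
  then show ?thesis using coset_rep_idem[OF ideal_J] by auto
qed

lemma reps_eqI:
  assumes "t \<in> reps k m" "t' \<in> reps k m" "\<And>i. i < k \<Longrightarrow> t ! i \<ominus> t' ! i \<in> J m"
  shows "t = t'"
proof -
  have v: "t \<in> vecs k" "t' \<in> vecs k" using assms reps_vecs by auto
  have "t ! i = t' ! i" if "i < k" for i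
    using coset_rep_eq_iff[OF ideal_J, of "t ! i" "t' ! i"] v that assms(3)[OF that] reps_nth assms(1,2)
    by (metis vecs_nth)
  then show ?thesis using v by (intro vecs_eqI)
qed

text \<open>The quotient of \<open>J m\<close> by \<open>J (Suc m)\<close> is killed by
  \<open>p\<close> and has order \<open>p ^ f\<close>, so \<open>f\<close> characters separate
  it.\<close>

lemma exists_separating_level_characters:
  assumes "m < n"
  shows "\<exists>\<psi>. (\<forall>i<f. add_char (\<psi> i) \<and> (\<forall>h\<in>J (Suc m). \<psi> i h = 1)) \<and>
              (\<forall>x\<in>J m. (\<forall>i<f. \<psi> i x = 1) \<longrightarrow> x \<in> J (Suc m))"
  unfolding add_char_def
proof (rule add.exists_separating_characters[OF _ prime_p])
  have "n - m = Suc (n - Suc m)" using assms by simp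
  then show "card (J m) \<le> p ^ f * card (J (Suc m))"
    using card_J[of m] card_J[of "Suc m"] assms by simp
qed (use finite_carrier subgroup_J J_Suc p_mult_J in \<open>auto simp: add_pow_def\<close>)

text \<open>The \<open>p\<close>-torsion is \<open>J (n - \<xi>)\<close>, and the characters from
  that level on rule out its nonzero elements. A common kernel without \<open>p\<close>-torsion is
  zero, because multiplication by \<open>p\<close> is nilpotent.\<close>

lemma eq_zero_of_separated:
  assumes \<psi>: "\<And>m i. m < n \<Longrightarrow> i < f \<Longrightarrow> add_char (\<psi> m i)"
    and sep: "\<And>m x. m < n \<Longrightarrow> x \<in> J m \<Longrightarrow> (\<And>i. i < f \<Longrightarrow> \<psi> m i x = 1) \<Longrightarrow> x \<in> J (Suc m)"
    and a: "a \<in> carrier R" "\<And>m i. n - \<xi> \<le> m \<Longrightarrow> m < n \<Longrightarrow> i < f \<Longrightarrow> \<psi> m i a = 1"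
  shows "a = \<zero>"
proof -
  define K where "K = {a \<in> carrier R. \<forall>m i. n - \<xi> \<le> m \<longrightarrow> m < n \<longrightarrow> i < f \<longrightarrow> \<psi> m i a = 1}"
  \<comment> \<open>Within the kernel, the characters attached to \<open>m\<close> push an element
    of \<open>J m\<close> into \<open>J (Suc m)\<close>, until \<open>J n\<close> is
    reached.\<close>
  have base: "x = \<zero>" if x: "x \<in> K" "x \<in> J (n - \<xi>)" for x
  proof -
    have "x \<in> J m" if "n - \<xi> \<le> m" "m \<le> n" for m
      using that
    proof (induction m rule: dec_induct)
      case base
      then show ?case using x by simp
    next
      case (step m)
      then show ?case using sep[of m x] x(1) by (auto simp: K_def)
    qed
    from this[of n] show ?thesis using J_n by simp
  qed
  \<comment> \<open>Multiplication by \<open>p\<close> preserves \<open>K\<close> and raises the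
    index \<open>i\<close> by one; \<open>j\<close> bounds how often this is needed to reach
    \<open>J (n - \<xi>)\<close>.\<close>
  have "x = \<zero>" if "x \<in> K" "x \<in> J i" "n - \<xi> \<le> i + j" for x i j
    using that
  proof (induction j arbitrary: x i)
    case 0
    then show ?case using base J_antimono[of "n - \<xi>" i] by auto
  next
    case (Suc j)
    have x: "x \<in> carrier R" using Suc by (simp add: K_def)
    have "\<psi> m i ([p] \<cdot> x) = 1" if "n - \<xi> \<le> m" "m < n" "i < f" for m i
      using add_char_add_pow[OF \<psi>[OF that(2,3)] x, of p] Suc.prems(1) that by (simp add: K_def)
    then have "[p] \<cdot> x \<in> K" using x by (simp add: K_def)
    then have "[p] \<cdot> x = \<zero>" using Suc.IH[of "[p] \<cdot> x" "Suc i"] p_mult_J Suc.prems by simp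
    then show ?case using base p_torsion[OF x] Suc.prems by simp
  qed
  from this[of a 0 n] show ?thesis using a by (auto simp: K_def J_0)
qed

section \<open>Upper bound: a faithful sum of monomial representations\<close>

theorem exists_faithful_rep_Hei:
  "\<exists>\<rho>. faithful_rep (Hei k R) (\<Sum>i<\<xi>. f * (p ^ f) ^ (k * (n - i))) \<rho>"
proof -
  obtain \<psi> where \<psi>: "\<And>m i. m < n \<Longrightarrow> i < f \<Longrightarrow> add_char (\<psi> m i)"
    "\<And>m i h. m < n \<Longrightarrow> i < f \<Longrightarrow> h \<in> J (Suc m) \<Longrightarrow> \<psi> m i h = 1"
    "\<And>m x. m < n \<Longrightarrow> x \<in> J m \<Longrightarrow> (\<And>i. i < f \<Longrightarrow> \<psi> m i x = 1) \<Longrightarrow> x \<in> J (Suc m)"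
  proof -
    let ?P = "\<lambda>m \<psi>. (\<forall>i<f. add_char (\<psi> i) \<and> (\<forall>h\<in>J (Suc m). \<psi> i h = 1)) \<and>
              (\<forall>x\<in>J m. (\<forall>i<f. \<psi> i x = 1) \<longrightarrow> x \<in> J (Suc m))"
    have "\<forall>m. \<exists>\<psi>. m < n \<longrightarrow> ?P m \<psi>"
      using exists_separating_level_characters by blast
    then obtain \<psi> where "\<forall>m. m < n \<longrightarrow> ?P m (\<psi> m)"
      using choice[of "\<lambda>m \<psi>. m < n \<longrightarrow> ?P m \<psi>"] by blast
    then show thesis using that[of \<psi>] by blast
  qed
  \<comment> \<open>The pair \<open>(i, l)\<close> in \<open>C\<close> names character number
    \<open>l\<close> attached to the level \<open>n - i\<close>. As \<open>\<psi> m\<close> is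
    trivial on \<open>J (Suc m)\<close>, the level \<open>L c\<close> belongs to
    \<open>m = L c - 1\<close>.\<close>
  define C where "C = {..<\<xi>} \<times> {..<f}"
  define L where "L = (\<lambda>c :: nat \<times> nat. n - fst c)"
  define \<chi> where "\<chi> = (\<lambda>c. \<psi> (L c - 1) (snd c))"
  have L: "L c - 1 < n" "Suc (L c - 1) = L c" "L c \<le> n" if "c \<in> C" for c
    using that \<xi>_le by (auto simp: C_def L_def)
  have \<chi>: "add_char (\<chi> c)" "\<And>h. h \<in> J (L c) \<Longrightarrow> \<chi> c h = 1" if "c \<in> C" for c
    using \<psi>(1)[OF L(1)[OF that], of "snd c"] \<psi>(2)[OF L(1)[OF that], of "snd c"] L(2)[OF that] that
    by (auto simp: \<chi>_def C_def)
  have sep: "a = b" if ab: "a \<in> carrier R" "b \<in> carrier R" "\<And>c. c \<in> C \<Longrightarrow> \<chi> c a = \<chi> c b" for a b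
  proof -
    have "a \<ominus> b = \<zero>"
    proof (rule eq_zero_of_separated[of \<psi>])
      fix m i assume m: "n - \<xi> \<le> m" "m < n" "i < f"
      \<comment> \<open>The index for which \<open>L ?c - 1 = m\<close>.\<close>
      let ?c = "(n - Suc m, i)"
      have c: "?c \<in> C" "\<chi> ?c = \<psi> m i" using m \<xi>_pos by (auto simp: C_def \<chi>_def L_def)
      show "\<psi> m i (a \<ominus> b) = 1"
        using add_char_minus[OF \<chi>(1)[OF c(1)] ab(1,2)] ab(3)[OF c(1)] add_char_nonzero[OF \<chi>(1)[OF c(1)] ab(2)] c(2)
        by simp
    qed (use \<psi> ab in auto)
    then show ?thesis using ab(1,2) minus_eq_zeroD by blast
  qed
  \<comment> \<open>\<open>\<chi> c\<close> is trivial on the ideal \<open>J (L c)\<close>, so its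
    value at \<open>x \<otimes> s\<close> depends only on \<open>s\<close> modulo that
    ideal.\<close>
  have \<chi>_cong: "\<chi> c (x \<otimes> s) = \<chi> c (x \<otimes> s')"
    if "c \<in> C" "x \<in> carrier R" "s \<in> carrier R" "s' \<in> carrier R" "s \<ominus> s' \<in> J (L c)" for c x s s'
  proof -
    have "x \<otimes> s = x \<otimes> (s \<ominus> s') \<oplus> x \<otimes> s'" using that(2-4) by algebra
    then show ?thesis
      using that add_char_add[OF \<chi>(1)[OF that(1)], of "x \<otimes> (s \<ominus> s')" "x \<otimes> s'"]
        \<chi>(2)[OF that(1) J_closed_mult[OF that(2,5)]] by simp
  qed
  define B where "B = Sigma C (\<lambda>c. reps k (L c))"
  \<comment> \<open>A group element translates \<open>t\<close> by \<open>y\<close> modulo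
    \<open>J (L c)\<close>, back to the chosen representatives; the summand \<open>c\<close> is
    preserved.\<close>
  define \<sigma> where "\<sigma> = (\<lambda>(x::'a list, y, z::'a) (c, t). (c, map2 (\<lambda>a b. coset_rep (J (L c)) (a \<oplus> b)) y t))"
  define \<alpha> where "\<alpha> = (\<lambda>(x, y::'a list, z) (c, t). \<chi> c (z \<oplus> dot k x t))"
  \<comment> \<open>The product form allows the entries of \<open>t\<close> to be replaced by
    congruent ones factor by factor.\<close>
  have \<alpha>_eq: "\<alpha> (x, y, z) (c, t) = \<chi> c z * (\<Prod>i<k. \<chi> c (x ! i \<otimes> t ! i))"
    if "c \<in> C" "t \<in> vecs k" "x \<in> vecs k" "z \<in> carrier R" for x y z c t
    using that by (simp add: \<alpha>_def add_char_add \<chi> add_char_dot)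
  have carB: "t \<in> vecs k" if "(c, t) \<in> B" for c t using that reps_vecs by (auto simp: B_def)
  note crep = coset_rep[OF ideal_J]
  have \<sigma>_closed: "(c, map2 (\<lambda>a b. coset_rep (J (L c)) (a \<oplus> b)) y t) \<in> B"
    if "y \<in> vecs k" "(c, t) \<in> B" for y c t
    using that carB[OF that(2)] by (auto simp: B_def intro!: repsI)
  have "\<exists>\<rho>. faithful_rep (Hei k R) (card B) \<rho>"
  proof (rule faithful_monomial_rep[where \<sigma> = \<sigma> and \<alpha> = \<alpha>])
    show "finite B" unfolding B_def C_def by (intro finite_SigmaI finite_reps) auto
  next
    fix g b assume gb: "g \<in> carrier (Hei k R)" "b \<in> B"
    obtain x y z where g: "g = (x, y, z)" "x \<in> vecs k" "y \<in> vecs k" "z \<in> carrier R"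
      using gb by (auto simp: Hei_carrier)
    obtain c t where ct: "b = (c, t)" by (cases b) blast
    have c: "c \<in> C" and t: "t \<in> vecs k" using gb ct carB by (auto simp: B_def)
    show "\<sigma> g b \<in> B" using \<sigma>_closed[OF g(3)] gb ct g by (simp add: \<sigma>_def)
    show "\<alpha> g b \<noteq> 0" using add_char_nonzero[OF \<chi>(1)[OF c]] g ct t by (simp add: \<alpha>_def)
  next
    fix g assume "g \<in> carrier (Hei k R)"
    then obtain x y z where g: "g = (x, y, z)" "y \<in> vecs k" by (auto simp: Hei_carrier)
    show "inj_on (\<sigma> g) B"
    proof (rule inj_onI)
      fix b b' assume b: "b \<in> B" "b' \<in> B" "\<sigma> g b = \<sigma> g b'"
      obtain c t where ct: "b = (c, t)" by (cases b) blast
      obtain t' where ct': "b' = (c, t')" using b(3) ct by (cases b') (auto simp: \<sigma>_def g)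
      have t: "t \<in> vecs k" "t' \<in> vecs k" "t \<in> reps k (L c)" "t' \<in> reps k (L c)"
        using b reps_vecs ct ct' by (auto simp: B_def)
      have "t ! i \<ominus> t' ! i \<in> J (L c)" if i: "i < k" for i
      proof -
        have car: "y ! i \<in> carrier R" "t ! i \<in> carrier R" "t' ! i \<in> carrier R" using t g i by auto
        have "coset_rep (J (L c)) (y ! i \<oplus> t ! i) = coset_rep (J (L c)) (y ! i \<oplus> t' ! i)"
          using b(3) t g i by (auto simp: \<sigma>_def ct ct' list_eq_iff_nth_eq)
        then have "(y ! i \<oplus> t ! i) \<ominus> (y ! i \<oplus> t' ! i) \<in> J (L c)"
          using car by (subst (asm) coset_rep_eq_iff[OF ideal_J]) auto
        moreover have "(y ! i \<oplus> t ! i) \<ominus> (y ! i \<oplus> t' ! i) = t ! i \<ominus> t' ! i"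
          using car by algebra
        ultimately show ?thesis by simp
      qed
      then show "b = b'" using t ct ct' reps_eqI by blast
    qed
  next
    fix g h b assume gh: "g \<in> carrier (Hei k R)" "h \<in> carrier (Hei k R)" and b: "b \<in> B"
    obtain x y z where g: "g = (x, y, z)" "x \<in> vecs k" "y \<in> vecs k" "z \<in> carrier R"
      using gh by (auto simp: Hei_carrier)
    obtain x' y' z' where h: "h = (x', y', z')" "x' \<in> vecs k" "y' \<in> vecs k" "z' \<in> carrier R"
      using gh by (auto simp: Hei_carrier)
    obtain c t where ct: "b = (c, t)" by (cases b) blast
    have c: "c \<in> C" and t: "t \<in> vecs k" using b ct carB by (auto simp: B_def)
    define s where "s = map2 (\<lambda>a b. coset_rep (J (L c)) (a \<oplus> b)) y' t"
    have s: "s \<in> vecs k" using carB[OF \<sigma>_closed[OF h(3)]] b ct unfolding s_def by blast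
    have "coset_rep (J (L c)) (y ! i \<oplus> y' ! i \<oplus> t ! i)
        = coset_rep (J (L c)) (y ! i \<oplus> coset_rep (J (L c)) (y' ! i \<oplus> t ! i))" if "i < k" for i
      using that g h t by (simp add: coset_rep_add_cong[OF ideal_J] a_assoc)
    then have 1: "\<sigma> (g \<otimes>\<^bsub>Hei k R\<^esub> h) b = \<sigma> g (\<sigma> h b)"
      using g h t by (auto simp: \<sigma>_def ct Hei_mult intro!: nth_equalityI)
    \<comment> \<open>\<open>s\<close> is the reduced form of \<open>vadd y' t\<close>, and
      \<open>\<chi> c\<close> does not see the difference; bilinearity of \<open>dot\<close> then
      yields the cocycle identity.\<close>
    have "\<chi> c (dot k x s) = \<chi> c (dot k x (vadd y' t))"
      using g h t s c crep
      by (simp add: add_char_dot \<chi>) (intro prod.cong refl \<chi>_cong, auto simp: s_def)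
    then have "\<alpha> (g \<otimes>\<^bsub>Hei k R\<^esub> h) b = \<alpha> g (\<sigma> h b) * \<alpha> h b"
      using g h t s c
      by (simp add: \<alpha>_def \<sigma>_def ct Hei_mult dot_vadd_left dot_vadd_right add_char_add \<chi> flip: s_def)
    with 1 show "\<sigma> (g \<otimes>\<^bsub>Hei k R\<^esub> h) b = \<sigma> g (\<sigma> h b) \<and>
        \<alpha> (g \<otimes>\<^bsub>Hei k R\<^esub> h) b = \<alpha> g (\<sigma> h b) * \<alpha> h b" by simp
  next
    fix g h assume gh: "g \<in> carrier (Hei k R)" "h \<in> carrier (Hei k R)"
      and eq: "\<And>b. b \<in> B \<Longrightarrow> \<sigma> g b = \<sigma> h b \<and> \<alpha> g b = \<alpha> h b"
    obtain x y z where g: "g = (x, y, z)" "x \<in> vecs k" "y \<in> vecs k" "z \<in> carrier R"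
      using gh by (auto simp: Hei_carrier)
    obtain x' y' z' where h: "h = (x', y', z')" "x' \<in> vecs k" "y' \<in> vecs k" "z' \<in> carrier R"
      using gh by (auto simp: Hei_carrier)
    \<comment> \<open>The representative of the zero vector. Its entries need not be
      \<open>\<zero>\<close>, but they pair trivially under \<open>\<chi> c\<close>.\<close>
    define t0 where "t0 = (\<lambda>c. replicate k (coset_rep (J (L c)) \<zero>))"
    have t0: "t0 c \<in> reps k (L c)" for c by (auto simp: t0_def intro!: repsI)
    have t0v: "t0 c \<in> vecs k" for c using t0 reps_vecs by blast
    have t0_one: "\<chi> c (u \<otimes> coset_rep (J (L c)) \<zero>) = 1" if "c \<in> C" "u \<in> carrier R" for c u
      using \<chi>_cong[OF that _ zero_closed, of "coset_rep (J (L c)) \<zero>"] crep[of \<zero>] that add_char_zero \<chi>(1)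
      by simp
    have "y = y'"
    proof (rule vecs_eqI[OF g(3) h(3)])
      fix i assume i: "i < k"
      \<comment> \<open>This summand has level \<open>n\<close>, and \<open>J n\<close> is zero, so
        the translation on it determines \<open>y\<close>.\<close>
      let ?c = "(0, 0) :: nat \<times> nat"
      have "(?c, t0 ?c) \<in> B" using \<xi>_pos f_pos t0 by (auto simp: B_def C_def)
      from eq[OF this] have "coset_rep (J n) (y ! i \<oplus> t0 ?c ! i) = coset_rep (J n) (y' ! i \<oplus> t0 ?c ! i)"
        using g h i t0v[of ?c] by (auto simp: \<sigma>_def L_def list_eq_iff_nth_eq)
      moreover have car: "y ! i \<in> carrier R" "y' ! i \<in> carrier R" "t0 ?c ! i \<in> carrier R"
        using g h i vecs_nth[OF t0v[of ?c] i] by auto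
      ultimately have "(y ! i \<oplus> t0 ?c ! i) \<ominus> (y' ! i \<oplus> t0 ?c ! i) = \<zero>"
        using coset_rep_eq_iff[OF ideal_J[of n]] J_n by auto
      moreover have "(y ! i \<oplus> t0 ?c ! i) \<ominus> (y' ! i \<oplus> t0 ?c ! i) = y ! i \<ominus> y' ! i"
        using car by algebra
      ultimately show "y ! i = y' ! i" using car minus_eq_zeroD by simp
    qed
    \<comment> \<open>At \<open>t0 c\<close> the inner product drops out, and the scalar is the
      value of \<open>\<chi> c\<close> at the central entry.\<close>
    have z\<chi>: "\<chi> c z = \<chi> c z'" if c: "c \<in> C" for c
    proof -
      have "(c, t0 c) \<in> B" using c t0 by (auto simp: B_def)
      from eq[OF this] show ?thesis
        using g h c t0v t0_one by (simp add: \<alpha>_eq) (simp add: t0_def)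
    qed
    have "z = z'" using sep g h z\<chi> by blast
    have "x = x'"
    proof (rule vecs_eqI[OF g(2) h(2)])
      fix j assume j: "j < k"
      show "x ! j = x' ! j"
      proof (rule sep)
        fix c assume c: "c \<in> C"
        \<comment> \<open>Represents the unit vector in direction \<open>j\<close>, so that the
          pairing isolates \<open>x ! j\<close>.\<close>
        define t where "t = (t0 c)[j := coset_rep (J (L c)) \<one>]"
        have t: "t \<in> reps k (L c)" using j by (auto simp: t_def t0_def nth_list_update intro!: repsI)
        have tv: "t \<in> vecs k" using t reps_vecs by blast
        have prod: "(\<Prod>i<k. \<chi> c (u ! i \<otimes> t ! i)) = \<chi> c (u ! j)" if u: "u \<in> vecs k" for u
        proof -
          have "(\<Prod>i<k. \<chi> c (u ! i \<otimes> t ! i)) = (\<Prod>i<k. if i = j then \<chi> c (u ! j) else 1)"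
          proof (rule prod.cong)
            fix i assume "i \<in> {..<k}"
            then have i: "i < k" by simp
            show "\<chi> c (u ! i \<otimes> t ! i) = (if i = j then \<chi> c (u ! j) else 1)"
              using i j u c t0_one[OF c, of "u ! i"] \<chi>_cong[OF c _ _ one_closed, of "u ! j" "coset_rep (J (L c)) \<one>"]
                crep[of \<one>]
              by (auto simp: t_def t0_def)
          qed simp
          then show ?thesis using j by simp
        qed
        have "(c, t) \<in> B" using c t by (auto simp: B_def)
        from eq[OF this] have "\<chi> c z * \<chi> c (x ! j) = \<chi> c z' * \<chi> c (x' ! j)"
          using g h c tv by (simp add: \<alpha>_eq prod)
        then show "\<chi> c (x ! j) = \<chi> c (x' ! j)"
          using z\<chi>[OF c] add_char_nonzero[OF \<chi>(1)[OF c] h(4)] by simp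
      qed (use g h j in auto)
    qed
    then show "g = h" using \<open>y = y'\<close> \<open>z = z'\<close> g h by simp
  qed
  moreover have "card B = (\<Sum>i<\<xi>. f * (p ^ f) ^ (k * (n - i)))"
  proof -
    have "card B = (\<Sum>c\<in>C. (p ^ f) ^ (k * (n - fst c)))"
      unfolding B_def using finite_reps L(3)
      by (subst card_SigmaI) (auto simp: C_def card_reps L_def)
    also have "\<dots> = (\<Sum>i<\<xi>. f * (p ^ f) ^ (k * (n - i)))"
      using sum.cartesian_product[of "\<lambda>i _. (p ^ f) ^ (k * (n - i))" "{..<f}" "{..<\<xi>}"]
      by (simp add: C_def case_prod_unfold)
    finally show ?thesis .
  qed
  ultimately show ?thesis by simp
qed

end

subsection \<open>Levels of central characters\<close>

text \<open>Summation by parts: as \<open>w\<close> is increasing, the extremal case has exactly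
  \<open>f\<close> elements at each of the \<open>\<xi>\<close> highest levels \<open>n\<close>,
  \<open>n - 1\<close> and so on.\<close>

lemma weighted_level_sum_ge:
  fixes w :: "nat \<Rightarrow> nat" and lvl :: "'s \<Rightarrow> nat"
  assumes fin: "finite S" and lvl: "\<And>s. s \<in> S \<Longrightarrow> lvl s \<le> n" and "\<xi> \<le> n" and w: "mono w"
    and cnt: "\<And>j. 0 < j \<Longrightarrow> j \<le> \<xi> \<Longrightarrow> f * j \<le> card {s \<in> S. n + 1 - j \<le> lvl s}"
  shows "(\<Sum>i<\<xi>. f * w (n - i)) \<le> (\<Sum>s\<in>S. w (lvl s))"
proof -
  define N where "N = (\<lambda>j. card {s \<in> S. n + 1 - j \<le> lvl s})"
  \<comment> \<open>Descending induction over levels; the surplus \<open>N j - f j\<close> is charged at the lowest level reached.\<close>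
  define W where "W = (\<lambda>j. \<Sum>s\<in>{s \<in> S. n + 1 - j \<le> lvl s}. w (lvl s))"
  have N: "f * j \<le> N j" if "j \<le> \<xi>" for j using cnt[of j] that by (cases "j = 0") (auto simp: N_def)
  have main: "(\<Sum>i<j. f * w (n - i)) + (N j - f * j) * w (n + 1 - j) \<le> W j" if "j \<le> \<xi>" for j
    using that
  proof (induction j)
    case 0
    have none: "{s \<in> S. n + 1 - 0 \<le> lvl s} = {}" using lvl by force
    show ?case unfolding N_def W_def none by simp
  next
    case (Suc j)
    let ?E = "{s \<in> S. lvl s = n - j}"
    have split: "{s \<in> S. n + 1 - Suc j \<le> lvl s} = {s \<in> S. n + 1 - j \<le> lvl s} \<union> ?E"
      "{s \<in> S. n + 1 - j \<le> lvl s} \<inter> ?E = {}"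
      using Suc.prems \<open>\<xi> \<le> n\<close> by auto
    have NS: "N (Suc j) = N j + card ?E"
      unfolding N_def split(1) using fin split(2) by (intro card_Un_disjoint) auto
    have WS: "W (Suc j) = W j + card ?E * w (n - j)"
    proof -
      have "(\<Sum>s\<in>?E. w (lvl s)) = (\<Sum>s\<in>?E. w (n - j))" by (rule sum.cong) auto
      moreover have "W (Suc j) = W j + (\<Sum>s\<in>?E. w (lvl s))"
        unfolding W_def split(1) using fin split(2) by (intro sum.union_disjoint) auto
      ultimately show ?thesis by simp
    qed
    have "(N j - f * j) * w (n - j) \<le> (N j - f * j) * w (n + 1 - j)"
      using monoD[OF w, of "n - j" "n + 1 - j"] by (intro mult_left_mono) auto
    then have "(\<Sum>i<j. f * w (n - i)) + (N j - f * j + card ?E) * w (n - j) \<le> W (Suc j)"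
      using Suc WS by (simp add: algebra_simps)
    moreover have "N j - f * j + card ?E = f + (N (Suc j) - f * Suc j)"
      using N[of j] N[of "Suc j"] Suc.prems NS by simp
    ultimately show ?case by (simp add: algebra_simps)
  qed
  have "(\<Sum>i<\<xi>. f * w (n - i)) \<le> W \<xi>" using main[of \<xi>] by simp
  also have "\<dots> \<le> (\<Sum>s\<in>S. w (lvl s))"
    unfolding W_def using fin by (intro sum_mono2) auto
  finally show ?thesis .
qed

context finite_chain_ring
begin

text \<open>The conductor exponent of \<open>\<psi>\<close>; it is 0 for the trivial
  character.\<close>

definition level :: "('a \<Rightarrow> complex) \<Rightarrow> nat" where
  "level \<psi> = (LEAST m. \<forall>z\<in>J m. \<psi> z = 1)"

lemma level:
  assumes "add_char \<psi>"
  shows "z \<in> J (level \<psi>) \<Longrightarrow> \<psi> z = 1" "level \<psi> \<le> n"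
    "\<lbrakk>m \<le> level \<psi>; 0 < m\<rbrakk> \<Longrightarrow> \<exists>z\<in>J (m - 1). \<psi> z \<noteq> 1"
proof -
  have n: "\<forall>z\<in>J n. \<psi> z = 1" using add_char_zero[OF assms] J_n by simp
  show "z \<in> J (level \<psi>) \<Longrightarrow> \<psi> z = 1"
    unfolding level_def using LeastI[of "\<lambda>m. \<forall>z\<in>J m. \<psi> z = 1", OF n] by blast
  show "level \<psi> \<le> n" unfolding level_def by (rule Least_le) (rule n)
  assume "m \<le> level \<psi>" "0 < m"
  then have "\<not> (\<forall>z\<in>J (m - 1). \<psi> z = 1)"
    using not_less_Least[of "m - 1" "\<lambda>m. \<forall>z\<in>J m. \<psi> z = 1"] by (simp add: level_def)
  then show "\<exists>z\<in>J (m - 1). \<psi> z \<noteq> 1" by blast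
qed

text \<open>If \<open>y\<close> were outside \<open>J (level \<psi>)\<close>, its multiples would
  cover \<open>J (level \<psi> - 1)\<close>, and \<open>\<psi>\<close> would be trivial there,
  against the minimality of the level.\<close>

lemma level_pairing_nondegenerate:
  assumes \<psi>: "add_char \<psi>" and y: "y \<in> carrier R" "\<And>r. r \<in> carrier R \<Longrightarrow> \<psi> (r \<otimes> y) = 1"
  shows "y \<in> J (level \<psi>)"
proof (cases "level \<psi>")
  case 0
  then show ?thesis using y J_0 by simp
next
  case (Suc m)
  show ?thesis
  proof (rule ccontr)
    assume "y \<notin> J (level \<psi>)"
    then have "\<psi> z = 1" if "z \<in> J m" for z
      using J_multiple[OF y(1) _ that] y(2) Suc by auto
    then show False using level(3)[OF \<psi>, of "Suc m"] Suc by auto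
  qed
qed

text \<open>Characters of level at most \<open>n - j\<close> are trivial on
  \<open>J (n - j)\<close>, so those of higher level already separate its points. Their values there
  are \<open>p\<close>-th roots of unity because \<open>j \<le> \<xi>\<close>, and comparing orders
  gives the count.\<close>

lemma card_high_level_ge:
  assumes fin: "finite S" and S: "\<And>\<psi>. \<psi> \<in> S \<Longrightarrow> add_char \<psi>"
    and sep: "\<And>u. u \<in> carrier R \<Longrightarrow> u \<noteq> \<zero> \<Longrightarrow> \<exists>\<psi>\<in>S. \<psi> u \<noteq> 1"
    and j: "0 < j" "j \<le> \<xi>"
  shows "f * j \<le> card {\<psi> \<in> S. n + 1 - j \<le> level \<psi>}"
proof -
  let ?S = "{\<psi> \<in> S. n + 1 - j \<le> level \<psi>}"
  let ?U = "{\<zeta> :: complex. \<zeta> ^ p = 1}"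
  have p: "0 < p" using prime_gt_0_nat[OF prime_p] .
  have jn: "j \<le> n" using j \<xi>_le by simp
  have Jsub: "J (n - j) \<subseteq> J (n - \<xi>)" using j by (intro J_antimono) simp
  have "card (J (n - j)) \<le> card (?S \<rightarrow>\<^sub>E ?U)"
  proof (rule card_inj_on_le)
    show "inj_on (\<lambda>z. \<lambda>\<psi>\<in>?S. \<psi> z) (J (n - j))"
    proof (rule inj_onI)
      fix z z' assume z: "z \<in> J (n - j)" "z' \<in> J (n - j)" "(\<lambda>\<psi>\<in>?S. \<psi> z) = (\<lambda>\<psi>\<in>?S. \<psi> z')"
      have car: "z \<in> carrier R" "z' \<in> carrier R" using z J_subset by auto
      have u: "z \<ominus> z' \<in> J (n - j)" using z J_minus by simp
      show "z = z'"
      proof (rule ccontr)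
        assume "z \<noteq> z'"
        then have "z \<ominus> z' \<noteq> \<zero>" using car minus_eq_zeroD by blast
        then obtain \<psi> where \<psi>: "\<psi> \<in> S" "\<psi> (z \<ominus> z') \<noteq> 1" using sep car by blast
        have "n + 1 - j \<le> level \<psi>"
        proof (rule ccontr)
          assume "\<not> n + 1 - j \<le> level \<psi>"
          then have "J (n - j) \<subseteq> J (level \<psi>)" using jn by (intro J_antimono) simp
          then show False using u \<psi> level(1)[OF S[OF \<psi>(1)]] by blast
        qed
        then have "\<psi> z = \<psi> z'" using \<psi>(1) fun_cong[OF z(3), of \<psi>] by simp
        then show False
          using \<psi>(2) add_char_minus[OF S[OF \<psi>(1)] car] add_char_nonzero[OF S[OF \<psi>(1)] car(2)] by simp
      qed
    qed
    show "(\<lambda>z. \<lambda>\<psi>\<in>?S. \<psi> z) ` J (n - j) \<subseteq> ?S \<rightarrow>\<^sub>E ?U"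
    proof clarify
      fix z assume z: "z \<in> J (n - j)"
      have "\<psi> z ^ p = 1" if "\<psi> \<in> S" for \<psi>
      proof -
        have zc: "z \<in> carrier R" using z J_subset by blast
        then have "[p] \<cdot> z = \<zero>" using p_torsion z Jsub by blast
        then show ?thesis
          using add_char_add_pow[OF S[OF that] zc, of p] add_char_zero[OF S[OF that]] by simp
      qed
      then show "(\<lambda>\<psi>\<in>?S. \<psi> z) \<in> ?S \<rightarrow>\<^sub>E ?U" by auto
    qed
    show "finite (?S \<rightarrow>\<^sub>E ?U)" using fin p by (intro finite_PiE) (auto intro: finite_roots_unity)
  qed
  also have "card (?S \<rightarrow>\<^sub>E ?U) = p ^ card ?S"
    using fin p by (subst card_PiE) (auto simp: card_roots_unity_eq)
  finally have "p ^ (f * j) \<le> p ^ card ?S" using card_J[of "n - j"] jn by (simp flip: power_mult)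
  then show ?thesis using prime_gt_1_nat[OF prime_p] by simp
qed

section \<open>Lower bound: counting weights in a faithful representation\<close>

theorem faithful_rep_Hei_dim_ge:
  assumes \<rho>: "faithful_rep (Hei k R) d \<rho>"
  shows "(\<Sum>i<\<xi>. f * (p ^ f) ^ (k * (n - i))) \<le> d"
proof -
  interpret H: group "Hei k R" by (rule group_Hei)
  let ?o = "replicate k \<zero>"
  \<comment> \<open>On these elements the term \<open>dot k x y'\<close> of the multiplication
    vanishes, so they form an abelian subgroup; it contains all central elements
    \<open>(?o, ?o, z)\<close>.\<close>
  let ?A = "vecs k \<times> {?o} \<times> carrier R"
  have AH: "?A \<subseteq> carrier (Hei k R)" by (auto simp: Hei_carrier)
  have Amult: "(x, ?o, z) \<otimes>\<^bsub>Hei k R\<^esub> (x', ?o, z') = (vadd x x', ?o, z \<oplus> z')"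
    if "x \<in> vecs k" "x' \<in> vecs k" "z \<in> carrier R" "z' \<in> carrier R" for x x' z z'
    using that by (simp add: Hei_mult)
  have A: "subgroup ?A (Hei k R)"
  proof (rule H.subgroupI)
    fix a assume a: "a \<in> ?A"
    then obtain x z where xz: "a = (x, ?o, z)" "x \<in> vecs k" "z \<in> carrier R" by auto
    let ?b = "(map (a_inv R) x, ?o, \<ominus> z)"
    have "?b \<otimes>\<^bsub>Hei k R\<^esub> a = \<one>\<^bsub>Hei k R\<^esub>"
      using xz by (simp add: Amult Hei_one l_neg)
    moreover have "?b \<in> ?A" using xz by simp
    ultimately have "inv\<^bsub>Hei k R\<^esub> a = ?b"
      by (intro H.inv_equality) (use a AH in blast)+
    then show "inv\<^bsub>Hei k R\<^esub> a \<in> ?A" using \<open>?b \<in> ?A\<close> by simp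
  next
    fix a b assume "a \<in> ?A" "b \<in> ?A"
    then show "a \<otimes>\<^bsub>Hei k R\<^esub> b \<in> ?A" by (auto simp: Amult)
  next
    show "?A \<noteq> {}" using vzero_closed[of k] by blast
  qed (rule AH)
  have Acomm: "a \<otimes>\<^bsub>Hei k R\<^esub> b = b \<otimes>\<^bsub>Hei k R\<^esub> a" if "a \<in> ?A" "b \<in> ?A" for a b
    using that by (auto simp: Amult vadd_comm[of _ k] a_comm)
  \<comment> \<open>For each nonzero \<open>u\<close>, a weight vector of \<open>?A\<close> and its
    weight, on which the central element of \<open>u\<close> acts nontrivially; pairing the two
    allows a single choice.\<close>
  define P where "P = (\<lambda>u (v, \<mu>). v \<in> carrier_vec d \<and> v \<noteq> 0\<^sub>v d \<and> (\<forall>g\<in>?A. \<rho> g *\<^sub>v v = \<mu> g \<cdot>\<^sub>v v) \<and>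
     \<mu> (?o, ?o, u) \<noteq> 1 \<and> \<mu> \<one>\<^bsub>Hei k R\<^esub> = 1 \<and> (\<forall>g\<in>?A. \<forall>h\<in>?A. \<mu> (g \<otimes>\<^bsub>Hei k R\<^esub> h) = \<mu> g * \<mu> h))"
  have "\<exists>v\<mu>. P u v\<mu>" if u: "u \<in> carrier R" "u \<noteq> \<zero>" for u
    using H.exists_abelian_weight[OF finite_Hei[OF finite_carrier] \<rho> A Acomm, of "(?o, ?o, u)"] u
    by (auto simp: Hei_one P_def)
  then obtain v\<mu> where v\<mu>: "\<And>u. u \<in> carrier R \<Longrightarrow> u \<noteq> \<zero> \<Longrightarrow> P u (v\<mu> u)"
    by metis
  define v where "v = (\<lambda>u. fst (v\<mu> u))"
  define \<mu> where "\<mu> = (\<lambda>u. snd (v\<mu> u))"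
  have v: "v u \<in> carrier_vec d" "v u \<noteq> 0\<^sub>v d" "\<And>g. g \<in> ?A \<Longrightarrow> \<rho> g *\<^sub>v v u = \<mu> u g \<cdot>\<^sub>v v u"
    "\<mu> u (?o, ?o, u) \<noteq> 1" "\<mu> u \<one>\<^bsub>Hei k R\<^esub> = 1"
    "\<And>g h. g \<in> ?A \<Longrightarrow> h \<in> ?A \<Longrightarrow> \<mu> u (g \<otimes>\<^bsub>Hei k R\<^esub> h) = \<mu> u g * \<mu> u h"
    if "u \<in> carrier R - {\<zero>}" for u
    using v\<mu>[of u] that by (auto simp: v_def \<mu>_def P_def case_prod_unfold)
  \<comment> \<open>Restricted to the carrier, so that central characters with the same values are
    equal as functions and \<open>S\<close> counts each of them once.\<close>
  define \<psi> where "\<psi> = (\<lambda>u. \<lambda>z\<in>carrier R. \<mu> u (?o, ?o, z))"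
  have \<psi>: "add_char (\<psi> u)" if u: "u \<in> carrier R - {\<zero>}" for u
    unfolding add_char_def is_character_def
  proof (intro conjI ballI)
    show "\<psi> u \<one>\<^bsub>add_monoid R\<^esub> = 1" using v(5)[OF u] by (simp add: \<psi>_def Hei_one)
  next
    fix x y assume "x \<in> carrier (add_monoid R)" "y \<in> carrier (add_monoid R)"
    then have xy: "x \<in> carrier R" "y \<in> carrier R" by auto
    then have "(?o, ?o, x \<oplus> y) = (?o, ?o, x) \<otimes>\<^bsub>Hei k R\<^esub> (?o, ?o, y)" by (simp add: Amult)
    then show "\<psi> u (x \<otimes>\<^bsub>add_monoid R\<^esub> y) = \<psi> u x * \<psi> u y"
      using v(6)[OF u, of "(?o, ?o, x)" "(?o, ?o, y)"] xy by (simp add: \<psi>_def)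
  qed
  define S where "S = \<psi> ` (carrier R - {\<zero>})"
  have finS: "finite S" using finite_carrier by (simp add: S_def)
  have S: "add_char s" if "s \<in> S" for s using that \<psi> by (auto simp: S_def)
  have sepS: "\<exists>s\<in>S. s u \<noteq> 1" if "u \<in> carrier R" "u \<noteq> \<zero>" for u
    using that v(4)[of u] by (intro bexI[of _ "\<psi> u"]) (auto simp: S_def \<psi>_def)
  \<comment> \<open>Different \<open>u\<close> may give the same central character; \<open>U\<close>
    keeps one weight vector for each member of \<open>S\<close>.\<close>
  define U where "U = inv_into (carrier R - {\<zero>}) \<psi>"
  have U: "U s \<in> carrier R - {\<zero>}" "\<psi> (U s) = s" if "s \<in> S" for s
    using that inv_into_into[of s \<psi> "carrier R - {\<zero>}"] f_inv_into_f[of s \<psi> "carrier R - {\<zero>}"]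
    unfolding S_def U_def by blast+
  have \<psi>_U: "\<mu> (U s) (?o, ?o, z) = s z" if "s \<in> S" "z \<in> carrier R" for s z
    using fun_cong[OF U(2)[OF that(1)], of z] that(2) by (simp add: \<psi>_def)
  define I where "I = Sigma S (\<lambda>s. reps k (level s))"
  \<comment> \<open>The translates of the weight vector by \<open>(?o, y, \<zero>)\<close>;
    conjugation turns the old weight into the one given by \<open>c\<close>.\<close>
  define w where "w = (\<lambda>(s, y). \<rho> (?o, y, \<zero>) *\<^sub>v v (U s))"
  define c where "c = (\<lambda>(x, z) (s, y). \<mu> (U s) (x, ?o, z \<oplus> dot k x y))"
  have c_eq: "c (x, z) (s, y) = \<mu> (U s) (x, ?o, z) * s (dot k x y)"
    if "s \<in> S" "x \<in> vecs k" "z \<in> carrier R" "y \<in> vecs k" for x z s y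
  proof -
    have "(x, ?o, z \<oplus> dot k x y) = (x, ?o, z) \<otimes>\<^bsub>Hei k R\<^esub> (?o, ?o, dot k x y)"
      using that by (simp add: Amult)
    then show ?thesis
      using v(6)[OF U(1)[OF that(1)], of "(x, ?o, z)" "(?o, ?o, dot k x y)"] that
      by (simp add: c_def \<psi>_U)
  qed
  have "card I \<le> d"
  proof (rule card_distinct_weights_le[where K = "vecs k \<times> carrier R" and w = w and c = c
        and A = "\<lambda>(x, z). \<rho> (x, ?o, z)"])
    show "finite I" unfolding I_def using finS finite_reps by blast
  next
    fix a assume "a \<in> vecs k \<times> carrier R"
    then show "(case a of (x, z) \<Rightarrow> \<rho> (x, ?o, z)) \<in> carrier_mat d d"
      using faithful_repD(1)[OF \<rho>] by (auto simp: Hei_carrier)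
  next
    fix i assume "i \<in> I"
    then obtain s y where i: "i = (s, y)" "s \<in> S" "y \<in> vecs k" unfolding I_def using reps_vecs by blast
    have u: "U s \<in> carrier R - {\<zero>}" by (rule U(1)[OF i(2)])
    have g: "(?o, y, \<zero>) \<in> carrier (Hei k R)" using i by (simp add: Hei_carrier)
    note gc = faithful_repD(1)[OF \<rho> g]
    show "w i \<in> carrier_vec d" using gc v(1)[OF u] i by (auto simp: w_def)
    show "w i \<noteq> 0\<^sub>v d"
    proof
      assume 0: "w i = 0\<^sub>v d"
      let ?h = "inv\<^bsub>Hei k R\<^esub> (?o, y, \<zero>)"
      have h: "\<rho> ?h \<in> carrier_mat d d" using g faithful_repD(1)[OF \<rho>] by simp
      have "v (U s) = \<rho> (?h \<otimes>\<^bsub>Hei k R\<^esub> (?o, y, \<zero>)) *\<^sub>v v (U s)"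
        using v(1)[OF u] H.faithful_rep_one[OF \<rho>] g by simp
      also have "\<dots> = \<rho> ?h *\<^sub>v w i"
        using assoc_mult_mat_vec[OF h gc v(1)[OF u]] faithful_repD(2)[OF \<rho> H.inv_closed[OF g] g] i
        by (simp add: w_def del: H.l_inv)
      also have "\<dots> = 0\<^sub>v d" using 0 h by auto
      finally show False using v(2)[OF u] by simp
    qed
    fix a assume "a \<in> vecs k \<times> carrier R"
    then obtain x z where a: "a = (x, z)" "x \<in> vecs k" "z \<in> carrier R" by auto
    have xz: "(x, ?o, z) \<in> carrier (Hei k R)" using a by (simp add: Hei_carrier)
    have xz': "(x, ?o, z \<oplus> dot k x y) \<in> ?A" "(x, ?o, z \<oplus> dot k x y) \<in> carrier (Hei k R)"
      using a i by (auto simp: Hei_carrier)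
    \<comment> \<open>Moving \<open>(x, ?o, z)\<close> past the translation shifts the central entry
      by \<open>dot k x y\<close>, which is how the weight comes to depend on
      \<open>y\<close>.\<close>
    have comm: "(x, ?o, z) \<otimes>\<^bsub>Hei k R\<^esub> (?o, y, \<zero>) = (?o, y, \<zero>) \<otimes>\<^bsub>Hei k R\<^esub> (x, ?o, z \<oplus> dot k x y)"
      using a i by (simp add: Hei_mult)
    have "\<rho> (x, ?o, z) *\<^sub>v w i = \<rho> ((x, ?o, z) \<otimes>\<^bsub>Hei k R\<^esub> (?o, y, \<zero>)) *\<^sub>v v (U s)"
      using faithful_repD(1,2)[OF \<rho>] xz g v(1)[OF u] i
      by (simp add: w_def assoc_mult_mat_vec[of _ d d _ d])
    also have "\<dots> = \<rho> (?o, y, \<zero>) *\<^sub>v (\<rho> (x, ?o, z \<oplus> dot k x y) *\<^sub>v v (U s))"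
      unfolding comm using faithful_repD(1,2)[OF \<rho>] xz' g v(1)[OF u] i
      by (simp add: assoc_mult_mat_vec[of _ d d _ d])
    also have "\<dots> = c a i \<cdot>\<^sub>v w i"
      using v(1,3)[OF u] xz' gc a i by (simp add: c_def w_def mult_mat_vec[of _ d d])
    finally show "(case a of (x, z) \<Rightarrow> \<rho> (x, ?o, z)) *\<^sub>v w i = c a i \<cdot>\<^sub>v w i"
      using a by simp
  next
    fix i j assume ij: "i \<in> I" "j \<in> I" "i \<noteq> j"
    obtain s y where i: "i = (s, y)" "s \<in> S" "y \<in> vecs k" "y \<in> reps k (level s)"
      using ij(1) reps_vecs unfolding I_def by blast
    obtain s' y' where j: "j = (s', y')" "s' \<in> S" "y' \<in> vecs k" "y' \<in> reps k (level s')"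
      using ij(2) reps_vecs unfolding I_def by blast
    show "\<exists>a\<in>vecs k \<times> carrier R. c a i \<noteq> c a j"
    proof (rule ccontr)
      assume "\<not> ?thesis"
      then have "\<forall>a\<in>vecs k \<times> carrier R. c a i = c a j" by blast
      then have eq: "c (x, z) i = c (x, z) j" if "x \<in> vecs k" "z \<in> carrier R" for x z
        using bspec[of _ _ "(x, z)"] that by blast
      \<comment> \<open>At \<open>x = 0\<close> the weight is the central character itself.\<close>
      have "s z = s' z" if z: "z \<in> carrier R" for z
        using eq[OF vzero_closed z] c_eq[OF i(2) vzero_closed z i(3)] c_eq[OF j(2) vzero_closed z j(3)]
          \<psi>_U[OF i(2) z] \<psi>_U[OF j(2) z] i(1) j(1) add_char_zero[OF S[OF i(2)]] add_char_zero[OF S[OF j(2)]] i(3) j(3) by simp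
      moreover have "s \<in> extensional (carrier R)" "s' \<in> extensional (carrier R)"
        using i(2) j(2) by (auto simp: S_def \<psi>_def)
      ultimately have ss: "s = s'" by (metis extensionalityI)
      \<comment> \<open>With the central characters equal, cancelling the common factor
        \<open>\<mu> (U s) (x, ?o, \<zero>)\<close> leaves only the pairing with
        \<open>x\<close>.\<close>
      have pair: "s (dot k x y) = s (dot k x y')" if x: "x \<in> vecs k" for x
      proof -
        have "\<mu> (U s) (x, ?o, \<zero>) * s (dot k x y) = \<mu> (U s) (x, ?o, \<zero>) * s (dot k x y')"
          using eq[OF x zero_closed] c_eq[OF i(2) x zero_closed i(3)] c_eq[OF j(2) x zero_closed j(3)] i j ss
          by auto
        moreover have "\<mu> (U s) (x, ?o, \<zero>) \<noteq> 0"
        proof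
          assume 0: "\<mu> (U s) (x, ?o, \<zero>) = 0"
          have u: "U s \<in> carrier R - {\<zero>}" by (rule U(1)[OF i(2)])
          have "\<one>\<^bsub>Hei k R\<^esub> = (map (a_inv R) x, ?o, \<zero>) \<otimes>\<^bsub>Hei k R\<^esub> (x, ?o, \<zero>)"
            using x by (simp add: Amult Hei_one)
          then show False
            using v(5)[OF u] v(6)[OF u, of "(map (a_inv R) x, ?o, \<zero>)" "(x, ?o, \<zero>)"] 0 x by simp
        qed
        ultimately show ?thesis by simp
      qed
      have "y = y'"
      proof (rule reps_eqI[OF i(4)])
        show "y' \<in> reps k (level s)" using j(4) ss by simp
        fix l assume l: "l < k"
        have car: "y ! l \<in> carrier R" "y' ! l \<in> carrier R" using i j l by auto
        show "y ! l \<ominus> y' ! l \<in> J (level s)"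
        proof (rule level_pairing_nondegenerate[OF S[OF i(2)]])
          fix r assume r: "r \<in> carrier R"
          \<comment> \<open>A vector with \<open>r\<close> in position \<open>l\<close> reduces the
            pairing to the single coordinate needed for
            \<open>level_pairing_nondegenerate\<close>.\<close>
          let ?x = "?o[l := r]"
          have x: "?x \<in> vecs k" using r l by (intro vecsI) (auto simp: nth_list_update)
          have s_dot: "s (dot k ?x t) = s (r \<otimes> t ! l)" if t: "t \<in> vecs k" for t
          proof -
            have "s (dot k ?x t) = (\<Prod>m<k. s (?x ! m \<otimes> t ! m))"
              by (rule add_char_dot[OF S[OF i(2)] x t])
            also have "\<dots> = (\<Prod>m<k. if m = l then s (r \<otimes> t ! l) else 1)"
              using t r l add_char_zero[OF S[OF i(2)]] by (intro prod.cong) auto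
            also have "\<dots> = s (r \<otimes> t ! l)" using l by simp
            finally show ?thesis .
          qed
          have "r \<otimes> (y ! l \<ominus> y' ! l) = r \<otimes> y ! l \<ominus> r \<otimes> y' ! l" using r car by algebra
          then show "s (r \<otimes> (y ! l \<ominus> y' ! l)) = 1"
            using add_char_minus[OF S[OF i(2)], of "r \<otimes> y ! l" "r \<otimes> y' ! l"]
              add_char_nonzero[OF S[OF i(2)], of "r \<otimes> y' ! l"]
              pair[OF x] s_dot[OF i(3)] s_dot[OF j(3)] r car by simp
        qed (use car in simp)
      qed
      then show False using ij i j ss by simp
    qed
  qed
  moreover have "card I = (\<Sum>s\<in>S. (p ^ f) ^ (k * level s))"
    unfolding I_def using finS finite_reps level(2)[OF S]
    by (subst card_SigmaI) (auto simp: card_reps)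
  \<comment> \<open>It remains to estimate the numbers of central characters at each level, where
    level \<open>m\<close> has the weight \<open>q^(k m)\<close> with
    \<open>q = p ^ f\<close>.\<close>
  moreover have "(\<Sum>i<\<xi>. f * (p ^ f) ^ (k * (n - i))) \<le> (\<Sum>s\<in>S. (p ^ f) ^ (k * level s))"
  proof (rule weighted_level_sum_ge[where w = "\<lambda>m. (p ^ f) ^ (k * m)"])
    show "mono (\<lambda>m. (p ^ f) ^ (k * m))"
      using prime_gt_0_nat[OF prime_p] by (intro monoI power_increasing) auto
  qed (use finS level(2)[OF S] \<xi>_le card_high_level_ge[OF finS S sepS] in auto)
  ultimately show ?thesis by simp
qed

theorem m_faithful_Hei: "m_faithful (Hei k R) = (\<Sum>i<\<xi>. f * (p ^ f) ^ (k * (n - i)))"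
  unfolding m_faithful_def
  by (rule Least_equality) (use exists_faithful_rep_Hei faithful_rep_Hei_dim_ge in blast)+

end

subsection \<open>Quotients of the ring of integers\<close>

locale discretely_valued_field =
  fixes \<nu> :: "'a::field \<Rightarrow> int"
  assumes discrete: "discrete_valuation \<nu>"
begin

lemma val_mult: "x \<noteq> 0 \<Longrightarrow> y \<noteq> 0 \<Longrightarrow> \<nu> (x * y) = \<nu> x + \<nu> y"
  using discrete by (simp add: discrete_valuation_def)

lemma val_one: "\<nu> 1 = 0"
  using val_mult[of 1 1] by simp

lemma val_uminus: "\<nu> (- x) = \<nu> x"
proof (cases "x = 0")
  case False
  have "\<nu> (- 1) = 0" using val_mult[of "- 1" "- 1"] val_one by simp
  then show ?thesis using val_mult[of "- 1" x] False by simp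
qed simp

lemma val_divide: "x \<noteq> 0 \<Longrightarrow> y \<noteq> 0 \<Longrightarrow> \<nu> (x / y) = \<nu> x - \<nu> y"
  using val_mult[of "x / y" y] by simp

lemma val_ge_zero [simp]: "val_ge \<nu> N 0"
  by (simp add: val_ge_def)

lemma val_ge_add: "val_ge \<nu> N x \<Longrightarrow> val_ge \<nu> N y \<Longrightarrow> val_ge \<nu> N (x + y)"
  using discrete unfolding val_ge_def discrete_valuation_def
  by (metis add.left_neutral add.right_neutral min.boundedI order_trans)

lemma val_ge_uminus: "val_ge \<nu> N (- x) \<longleftrightarrow> val_ge \<nu> N x"
  by (simp add: val_ge_def val_uminus)

lemma val_ge_diff: "val_ge \<nu> N x \<Longrightarrow> val_ge \<nu> N y \<Longrightarrow> val_ge \<nu> N (x - y)"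
  using val_ge_add[of N x "- y"] by (simp add: val_ge_uminus)

lemma val_ge_diff_swap: "val_ge \<nu> N (x - y) \<longleftrightarrow> val_ge \<nu> N (y - x)"
  using val_ge_uminus[of N "x - y"] by simp

lemma val_ge_mult: "val_ge \<nu> M x \<Longrightarrow> val_ge \<nu> N y \<Longrightarrow> val_ge \<nu> (M + N) (x * y)"
  using val_mult[of x y] by (fastforce simp: val_ge_def)

lemma val_ge_mono: "val_ge \<nu> N x \<Longrightarrow> M \<le> N \<Longrightarrow> val_ge \<nu> M x"
  by (auto simp: val_ge_def)

lemma val_ge_int: "val_ge \<nu> (int i) x \<Longrightarrow> val_ge \<nu> 0 x"
  using val_ge_mono[of "int i" x 0] by simp

lemma val_ge_one: "val_ge \<nu> N 1 \<longleftrightarrow> N \<le> 0"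
  by (simp add: val_ge_def val_one)

lemma val_ge_of_nat: "val_ge \<nu> 0 (of_nat m)"
  by (induction m) (auto intro: val_ge_add simp: val_ge_one)

definition uniformizer :: 'a where
  "uniformizer = (SOME x. x \<noteq> 0 \<and> \<nu> x = 1)"

lemma uniformizer: "uniformizer \<noteq> 0" "\<nu> uniformizer = 1"
proof -
  have "\<exists>x. x \<noteq> 0 \<and> \<nu> x = 1" using discrete by (simp add: discrete_valuation_def)
  from someI_ex[OF this] show "uniformizer \<noteq> 0" "\<nu> uniformizer = 1"
    by (auto simp: uniformizer_def)
qed

lemma val_uniformizer_power: "\<nu> (uniformizer ^ i) = int i"
  by (induction i) (auto simp: val_one val_mult uniformizer)

lemma val_ge_uniformizer_power_mult: "val_ge \<nu> (int i + N) (uniformizer ^ i * x) \<longleftrightarrow> val_ge \<nu> N x"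
  by (cases "x = 0") (auto simp: val_ge_def val_mult uniformizer val_uniformizer_power)

lemma int_ring_simps [simp]:
  "x \<in> carrier (int_ring \<nu>) \<longleftrightarrow> val_ge \<nu> 0 x" "x \<otimes>\<^bsub>int_ring \<nu>\<^esub> y = x * y" "x \<oplus>\<^bsub>int_ring \<nu>\<^esub> y = x + y"
  "\<one>\<^bsub>int_ring \<nu>\<^esub> = 1" "\<zero>\<^bsub>int_ring \<nu>\<^esub> = 0"
  by (auto simp: int_ring_def)

lemma mem_max_ideal_pow: "x \<in> max_ideal_pow \<nu> i \<longleftrightarrow> val_ge \<nu> (int i) x"
  by (simp add: max_ideal_pow_def)

lemma cring_int_ring: "cring (int_ring \<nu>)"
proof (rule cringI)
  show "abelian_group (int_ring \<nu>)"
  proof (rule abelian_groupI)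
    fix x assume "x \<in> carrier (int_ring \<nu>)"
    then show "\<exists>y\<in>carrier (int_ring \<nu>). y \<oplus>\<^bsub>int_ring \<nu>\<^esub> x = \<zero>\<^bsub>int_ring \<nu>\<^esub>"
      by (intro bexI[of _ "- x"]) (auto simp: val_ge_uminus)
  qed (auto intro: val_ge_add)
  show "comm_monoid (int_ring \<nu>)"
    by (rule comm_monoidI) (use val_ge_mult[of 0 _ 0] in \<open>auto simp: val_ge_one mult.commute\<close>)
qed (auto simp: algebra_simps)

sublocale O: cring "int_ring \<nu>"
  by (rule cring_int_ring)

lemma ideal_max_ideal_pow: "ideal (max_ideal_pow \<nu> i) (int_ring \<nu>)"
proof (rule idealI)
  show "subgroup (max_ideal_pow \<nu> i) (add_monoid (int_ring \<nu>))"
  proof (rule O.add.subgroupI)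
    fix x assume x: "x \<in> max_ideal_pow \<nu> i"
    then have "x \<in> carrier (int_ring \<nu>)" by (auto simp: mem_max_ideal_pow intro: val_ge_int)
    then have "\<ominus>\<^bsub>int_ring \<nu>\<^esub> x = - x" by (intro O.minus_equality) (auto simp: val_ge_uminus)
    then show "\<ominus>\<^bsub>int_ring \<nu>\<^esub> x \<in> max_ideal_pow \<nu> i" using x by (simp add: mem_max_ideal_pow val_ge_uminus)
  next
    show "max_ideal_pow \<nu> i \<noteq> {}" using mem_max_ideal_pow[of 0 i] by auto
  qed (auto simp: mem_max_ideal_pow intro: val_ge_int val_ge_add)
qed (use O.ring_axioms val_ge_mult[of "int i" _ 0] val_ge_mult[of 0 _ "int i"] in \<open>auto simp: mem_max_ideal_pow\<close>)

section \<open>Residue classes and the filtration by powers of the maximal ideal\<close>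

definition cls :: "nat \<Rightarrow> 'a \<Rightarrow> 'a set" where
  "cls n x = max_ideal_pow \<nu> n +>\<^bsub>int_ring \<nu>\<^esub> x"

lemma cls_eq_iff: "cls n x = cls n y \<longleftrightarrow> val_ge \<nu> (int n) (x - y)"
proof -
  have cls: "cls n x = {z. val_ge \<nu> (int n) (z - x)}" for x
  proof (intro equalityI subsetI)
    fix z assume "z \<in> {z. val_ge \<nu> (int n) (z - x)}"
    then have "z - x \<in> max_ideal_pow \<nu> n" "z = (z - x) + x" by (auto simp: mem_max_ideal_pow)
    then show "z \<in> cls n x" unfolding cls_def a_r_coset_def r_coset_def by force
  qed (auto simp: cls_def a_r_coset_def r_coset_def mem_max_ideal_pow)
  show ?thesis
  proof
    assume "cls n x = cls n y"
    then have "x \<in> cls n y" using cls by auto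
    then show "val_ge \<nu> (int n) (x - y)" using cls by auto
  next
    assume xy: "val_ge \<nu> (int n) (x - y)"
    have "val_ge \<nu> (int n) (z - x) \<longleftrightarrow> val_ge \<nu> (int n) (z - y)" for z
      using val_ge_add[of "int n" "z - x" "x - y"] val_ge_diff[of "int n" "z - y" "x - y"] xy by auto
    then show "cls n x = cls n y" using cls by auto
  qed
qed

lemma cring_O_mod: "cring (O_mod \<nu> n)"
  unfolding O_mod_def by (rule ideal.quotient_is_cring[OF ideal_max_ideal_pow cring_int_ring])

lemma cls_hom: "ring_hom_ring (int_ring \<nu>) (O_mod \<nu> n) (cls n)"
  using ideal.rcos_ring_hom_ring[OF ideal_max_ideal_pow] by (simp add: O_mod_def cls_def[abs_def])

lemma carrier_O_mod: "carrier (O_mod \<nu> n) = cls n ` {x. val_ge \<nu> 0 x}"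
proof -
  have "carrier (int_ring \<nu>) = {x. val_ge \<nu> 0 x}" by auto
  then show ?thesis
    by (auto simp: O_mod_def FactRing_def A_RCOSETS_def RCOSETS_def cls_def a_r_coset_def)
qed

lemma cls_ring:
  assumes "val_ge \<nu> 0 x" "val_ge \<nu> 0 y"
  shows "cls n x \<oplus>\<^bsub>O_mod \<nu> n\<^esub> cls n y = cls n (x + y)" "cls n x \<otimes>\<^bsub>O_mod \<nu> n\<^esub> cls n y = cls n (x * y)"
proof -
  interpret h: ring_hom_ring "int_ring \<nu>" "O_mod \<nu> n" "cls n" by (rule cls_hom)
  show "cls n x \<oplus>\<^bsub>O_mod \<nu> n\<^esub> cls n y = cls n (x + y)" "cls n x \<otimes>\<^bsub>O_mod \<nu> n\<^esub> cls n y = cls n (x * y)"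
    using h.hom_add[of x y] h.hom_mult[of x y] assms by auto
qed

lemma cls_zero: "\<zero>\<^bsub>O_mod \<nu> n\<^esub> = cls n 0"
proof -
  interpret h: ring_hom_ring "int_ring \<nu>" "O_mod \<nu> n" "cls n" by (rule cls_hom)
  show ?thesis using h.hom_zero by simp
qed

lemma cls_add_pow:
  assumes "val_ge \<nu> 0 x"
  shows "add_pow (O_mod \<nu> n) (m :: nat) (cls n x) = cls n (of_nat m * x)"
proof -
  interpret Q: cring "O_mod \<nu> n" by (rule cring_O_mod)
  have mx: "val_ge \<nu> 0 (of_nat m * x)" for m using val_ge_mult[OF val_ge_of_nat assms] by simp
  show ?thesis
  proof (induction m)
    case 0
    then show ?case by (simp add: cls_zero)
  next
    case (Suc m)
    then show ?case using cls_ring(1)[OF mx assms, of n m] by (simp add: algebra_simps)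
  qed
qed

text \<open>The ideal \<open>p^i / p^n\<close>, in the role of \<open>J i\<close>; it is zero for
  \<open>i \<ge> n\<close>.\<close>

definition filt :: "nat \<Rightarrow> nat \<Rightarrow> 'a set set" where
  "filt n i = cls n ` max_ideal_pow \<nu> i"

lemma cls_in_filt_iff: assumes "i \<le> n" shows "cls n x \<in> filt n i \<longleftrightarrow> val_ge \<nu> (int i) x"
proof
  assume "cls n x \<in> filt n i"
  then obtain y where y: "val_ge \<nu> (int i) y" "val_ge \<nu> (int n) (x - y)"
    by (auto simp: filt_def mem_max_ideal_pow cls_eq_iff)
  have "val_ge \<nu> (int i) (x - y)" using y(2) assms by (auto intro: val_ge_mono)
  then show "val_ge \<nu> (int i) x" using val_ge_add[OF y(1)] by fastforce
qed (auto simp: filt_def mem_max_ideal_pow)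

text \<open>Expansion by one digit: with fixed lifts of the residue field, an element of
  \<open>filt n i\<close> is uniquely a lifted digit times \<open>uniformizer ^ i\<close> plus an
  element of \<open>filt n (Suc i)\<close>.\<close>

lemma bij_betw_filt_step:
  assumes i: "i < n"
  shows "bij_betw (\<lambda>(X, b). cls n (uniformizer ^ i * inv_into {x. val_ge \<nu> 0 x} (cls 1) X) \<oplus>\<^bsub>O_mod \<nu> n\<^esub> b)
    (carrier (O_mod \<nu> 1) \<times> filt n (Suc i)) (filt n i)"
proof -
  let ?r = "inv_into {x. val_ge \<nu> 0 x} (cls 1)"
  have r: "val_ge \<nu> 0 (?r X)" "cls 1 (?r X) = X" if "X \<in> carrier (O_mod \<nu> 1)" for X
    using inv_into_into[of X "cls 1" "{x. val_ge \<nu> 0 x}"] f_inv_into_f[of X "cls 1" "{x. val_ge \<nu> 0 x}"]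
      that carrier_O_mod[of 1] by auto
  have pr: "val_ge \<nu> (int i) (uniformizer ^ i * ?r X)" if "X \<in> carrier (O_mod \<nu> 1)" for X
    using val_ge_uniformizer_power_mult[of i 0] r(1)[OF that] by simp
  have filt0: "\<exists>b. B = cls n b \<and> val_ge \<nu> (int j) b \<and> val_ge \<nu> 0 b" if "B \<in> filt n j" for B j
    using that val_ge_int unfolding filt_def image_iff Bex_def mem_max_ideal_pow by blast
  show ?thesis
  proof (intro bij_betw_imageI)
    show "inj_on (\<lambda>(X, b). cls n (uniformizer ^ i * ?r X) \<oplus>\<^bsub>O_mod \<nu> n\<^esub> b)
        (carrier (O_mod \<nu> 1) \<times> filt n (Suc i))"
    proof (rule inj_onI, clarify)
      fix X B X' B'
      assume X: "X \<in> carrier (O_mod \<nu> 1)" "X' \<in> carrier (O_mod \<nu> 1)"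
        and B: "B \<in> filt n (Suc i)" "B' \<in> filt n (Suc i)"
        and eq: "cls n (uniformizer ^ i * ?r X) \<oplus>\<^bsub>O_mod \<nu> n\<^esub> B = cls n (uniformizer ^ i * ?r X') \<oplus>\<^bsub>O_mod \<nu> n\<^esub> B'"
      obtain b where b: "B = cls n b" "val_ge \<nu> (int (Suc i)) b" "val_ge \<nu> 0 b" using filt0[OF B(1)] by blast
      obtain b' where b': "B' = cls n b'" "val_ge \<nu> (int (Suc i)) b'" "val_ge \<nu> 0 b'" using filt0[OF B(2)] by blast
      have v0: "val_ge \<nu> 0 (uniformizer ^ i * ?r X)" "val_ge \<nu> 0 (uniformizer ^ i * ?r X')"
        using pr[OF X(1)] pr[OF X(2)] by (auto intro: val_ge_int)
      have "val_ge \<nu> (int n) ((uniformizer ^ i * ?r X + b) - (uniformizer ^ i * ?r X' + b'))"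
        using eq b b' v0 by (simp add: cls_ring cls_eq_iff)
      then have "val_ge \<nu> (int (Suc i)) ((uniformizer ^ i * ?r X + b) - (uniformizer ^ i * ?r X' + b'))"
        by (rule val_ge_mono) (use i in simp)
      from val_ge_diff[OF this val_ge_diff[OF b(2) b'(2)]]
      have "val_ge \<nu> (int i + 1) (uniformizer ^ i * (?r X - ?r X'))"
        by (simp add: algebra_simps)
      then have "val_ge \<nu> 1 (?r X - ?r X')" by (simp only: val_ge_uniformizer_power_mult)
      then have "cls 1 (?r X) = cls 1 (?r X')" by (simp add: cls_eq_iff)
      then have XX: "X = X'" using r(2) X by simp
      have "B = B'"
        using eq XX b b' v0 by (simp add: cls_ring cls_eq_iff)
      with XX show "X = X' \<and> B = B'" by simp
    qed
    show "(\<lambda>(X, b). cls n (uniformizer ^ i * ?r X) \<oplus>\<^bsub>O_mod \<nu> n\<^esub> b) `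
        (carrier (O_mod \<nu> 1) \<times> filt n (Suc i)) = filt n i"
    proof (intro equalityI subsetI)
      fix Y assume "Y \<in> (\<lambda>(X, b). cls n (uniformizer ^ i * ?r X) \<oplus>\<^bsub>O_mod \<nu> n\<^esub> b) `
        (carrier (O_mod \<nu> 1) \<times> filt n (Suc i))"
      then obtain X B where X: "X \<in> carrier (O_mod \<nu> 1)" and B: "B \<in> filt n (Suc i)"
        and Y: "Y = cls n (uniformizer ^ i * ?r X) \<oplus>\<^bsub>O_mod \<nu> n\<^esub> B" by auto
      obtain b where b: "B = cls n b" "val_ge \<nu> (int (Suc i)) b" "val_ge \<nu> 0 b" using filt0[OF B] by blast
      have "val_ge \<nu> 0 (uniformizer ^ i * ?r X)" using pr[OF X] by (rule val_ge_int)
      then have "Y = cls n (uniformizer ^ i * ?r X + b)" using Y b by (simp add: cls_ring)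
      moreover have "val_ge \<nu> (int i) b" by (rule val_ge_mono[OF b(2)]) simp
      ultimately show "Y \<in> filt n i"
        using val_ge_add[OF pr[OF X], of b] unfolding filt_def mem_max_ideal_pow[symmetric] by blast
    next
      fix Y assume "Y \<in> filt n i"
      then obtain y where y: "Y = cls n y" "val_ge \<nu> (int i) y" by (auto simp: filt_def mem_max_ideal_pow)
      \<comment> \<open>\<open>t\<close> is integral because \<open>y\<close> has valuation at least
        \<open>i\<close>; its residue is the leading digit of \<open>y\<close>.\<close>
      define t where "t = y / uniformizer ^ i"
      have yt: "y = uniformizer ^ i * t" using uniformizer(1) by (simp add: t_def)
      have t: "val_ge \<nu> 0 t" using y(2) val_ge_uniformizer_power_mult[of i 0 t] yt by simp
      have X: "cls 1 t \<in> carrier (O_mod \<nu> 1)" using t by (auto simp: carrier_O_mod)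
      let ?b = "uniformizer ^ i * (t - ?r (cls 1 t))"
      have "val_ge \<nu> 1 (t - ?r (cls 1 t))"
        using r(2)[OF X] cls_eq_iff[of 1 "?r (cls 1 t)" t] by (simp add: val_ge_diff_swap)
      then have b: "val_ge \<nu> (int i + 1) ?b" by (simp only: val_ge_uniformizer_power_mult)
      have v0: "val_ge \<nu> 0 ?b" "val_ge \<nu> 0 (uniformizer ^ i * ?r (cls 1 t))"
        by (rule val_ge_mono[OF b], simp) (rule val_ge_mono[OF pr[OF X]], simp)
      have "cls n ?b \<in> filt n (Suc i)" using b by (auto simp: filt_def mem_max_ideal_pow add.commute)
      moreover have "Y = cls n (uniformizer ^ i * ?r (cls 1 t)) \<oplus>\<^bsub>O_mod \<nu> n\<^esub> cls n ?b"
        using v0 by (simp add: cls_ring y(1) yt algebra_simps)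
      ultimately show "Y \<in> (\<lambda>(X, b). cls n (uniformizer ^ i * ?r X) \<oplus>\<^bsub>O_mod \<nu> n\<^esub> b) `
        (carrier (O_mod \<nu> 1) \<times> filt n (Suc i))"
        using X by (intro image_eqI[where x = "(cls 1 t, cls n ?b)"]) auto
    qed
  qed
qed

lemma filt_top: "filt n n = {\<zero>\<^bsub>O_mod \<nu> n\<^esub>}"
proof -
  have "cls n x = cls n 0" if "x \<in> max_ideal_pow \<nu> n" for x
    using that cls_eq_iff[of n x 0] by (simp add: mem_max_ideal_pow)
  moreover have "0 \<in> max_ideal_pow \<nu> n" by (simp add: mem_max_ideal_pow)
  ultimately show ?thesis unfolding filt_def cls_zero by blast
qed

text \<open>Descending from \<open>n\<close>, each step multiplies the order by that of the residue
  field.\<close>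

lemma finite_filt_card:
  assumes fin: "finite (carrier (O_mod \<nu> 1))" and "i \<le> n"
  shows "finite (filt n i) \<and> card (filt n i) = residue_card \<nu> ^ (n - i)"
  using assms(2)
proof (induction i rule: inc_induct)
  case base
  then show ?case by (simp add: filt_top)
next
  case (step i)
  note bij = bij_betw_filt_step[OF step.hyps(2)]
  have "finite (filt n i)" using bij_betw_finite[OF bij] step.IH fin by simp
  moreover have "card (filt n i) = residue_card \<nu> * residue_card \<nu> ^ (n - Suc i)"
    using bij_betw_same_card[OF bij] step.IH by (simp add: card_cartesian_product residue_card_def)
  moreover have "n - i = Suc (n - Suc i)" using step.hyps by simp
  ultimately show ?case by simp
qed

lemma filt_zero: "filt n 0 = carrier (O_mod \<nu> n)"
  by (simp add: filt_def carrier_O_mod max_ideal_pow_def)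

section \<open>Residue characteristic, inertia degree and truncated ramification\<close>

context
  assumes fin: "finite (carrier (O_mod \<nu> 1))"
begin

text \<open>Two natural numbers have the same image in the finite residue field; their difference
  lies in the maximal ideal.\<close>

lemma residue_char_exists: "\<exists>m>0. val_ge \<nu> 1 (of_nat m)"
proof -
  have "range (\<lambda>i. cls 1 (of_nat i)) \<subseteq> carrier (O_mod \<nu> 1)" using val_ge_of_nat by (auto simp: carrier_O_mod)
  then have "finite (range (\<lambda>i :: nat. cls 1 (of_nat i)))" using fin finite_subset by blast
  then have "\<not> inj (\<lambda>i :: nat. cls 1 (of_nat i))" using finite_imageD infinite_UNIV_nat by blast
  then obtain i j :: nat where ij: "i < j" "cls 1 (of_nat i) = cls 1 (of_nat j)"
    by (metis linorder_injI)
  then have "val_ge \<nu> 1 (of_nat j - of_nat i)" using cls_eq_iff[of 1 "of_nat j" "of_nat i"] by simp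
  then show ?thesis using ij(1) by (intro exI[of _ "j - i"]) (simp add: of_nat_diff)
qed

lemma residue_char: "residue_char \<nu> > 0" "val_ge \<nu> 1 (of_nat (residue_char \<nu>))"
  using LeastI_ex[OF residue_char_exists] by (auto simp: residue_char_def)

lemma residue_char_least: "0 < m \<Longrightarrow> val_ge \<nu> 1 (of_nat m) \<Longrightarrow> residue_char \<nu> \<le> m"
  unfolding residue_char_def by (rule Least_le) simp

text \<open>If a product of two naturals lies in the maximal ideal, so does one factor, and by
  minimality that factor is not smaller than the product.\<close>

lemma prime_residue_char: "prime (residue_char \<nu>)"
proof -
  have "residue_char \<nu> \<noteq> 1" using residue_char(2) val_ge_one[of 1] by auto
  moreover have "a = 1 \<or> b = 1" if ab: "residue_char \<nu> = a * b" for a b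
  proof -
    have pos: "a > 0" "b > 0" using residue_char(1) ab by auto
    have "val_ge \<nu> 1 (of_nat a) \<or> val_ge \<nu> 1 (of_nat b)"
    \<comment> \<open>A factor may vanish in the field when the characteristic is positive; it then
      satisfies every valuation bound by convention.\<close>
    proof (cases "of_nat a = (0::'a) \<or> of_nat b = (0::'a)")
      case False
      then have "\<nu> (of_nat a) + \<nu> (of_nat b) \<ge> 1"
        using residue_char(2) ab val_mult[of "of_nat a" "of_nat b"] by (auto simp: val_ge_def)
      then show ?thesis by (auto simp: val_ge_def)
    qed (auto simp: val_ge_def)
    then have "a * b \<le> a \<or> a * b \<le> b" using residue_char_least[of a] residue_char_least[of b] pos ab by auto
    then show ?thesis using pos by auto
  qed
  ultimately show ?thesis using residue_char(1)
    by (metis One_nat_def Suc_lessI dvd_def mult_1_right nat_mult_1 nat_neq_iff prime_nat_iff)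
qed

text \<open>The additive group of the residue field is killed by the residue characteristic, so its
  order is a power of that prime. The exponent is positive because 0 and 1 have different
  residues.\<close>

lemma residue_card_eq: "residue_card \<nu> = residue_char \<nu> ^ inertia_degree \<nu>"
  and inertia_degree_pos: "inertia_degree \<nu> > 0"
proof -
  interpret Q: cring "O_mod \<nu> 1" by (rule cring_O_mod)
  have "\<exists>j. card (carrier (O_mod \<nu> 1)) = residue_char \<nu> ^ j"
  proof (rule Q.add.card_elementary_abelian[OF _ prime_residue_char])
    show "subgroup (carrier (O_mod \<nu> 1)) (add_monoid (O_mod \<nu> 1))"
      using Q.add.subgroup_self by simp
    fix X assume "X \<in> carrier (O_mod \<nu> 1)"
    then obtain x where x: "X = cls 1 x" "val_ge \<nu> 0 x" by (auto simp: carrier_O_mod)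
    have "val_ge \<nu> 1 (of_nat (residue_char \<nu>) * x)" using val_ge_mult[OF residue_char(2) x(2)] by simp
    then show "add_pow (O_mod \<nu> 1) (residue_char \<nu>) X = \<zero>\<^bsub>O_mod \<nu> 1\<^esub>"
      using x cls_eq_iff[of 1 _ 0] by (simp add: cls_add_pow cls_zero)
  qed (use fin in simp)
  then obtain j where j: "residue_card \<nu> = residue_char \<nu> ^ j" by (auto simp: residue_card_def)
  have "inertia_degree \<nu> = j"
    unfolding inertia_degree_def
    by (rule the_equality) (use j prime_gt_1_nat[OF prime_residue_char] in auto)
  then show eq: "residue_card \<nu> = residue_char \<nu> ^ inertia_degree \<nu>" using j by simp
  show "inertia_degree \<nu> > 0"
  proof (rule ccontr)
    assume "\<not> inertia_degree \<nu> > 0"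
    then have "card (carrier (O_mod \<nu> 1)) = 1" using eq by (simp add: residue_card_def)
    then obtain X where "carrier (O_mod \<nu> 1) = {X}" by (auto simp: card_1_singleton_iff)
    moreover have "cls 1 0 \<in> carrier (O_mod \<nu> 1)" "cls 1 1 \<in> carrier (O_mod \<nu> 1)"
      by (auto simp: carrier_O_mod val_ge_one)
    ultimately have "cls 1 1 = cls 1 0" by auto
    then show False by (simp add: cls_eq_iff val_ge_one)
  qed
qed

text \<open>Multiplication by \<open>p\<close> raises valuations by \<open>e\<close>, so it carries
  \<open>x\<close> into the \<open>n\<close>-th power of the maximal ideal exactly when
  \<open>x\<close> lies in the power \<open>n - min e n\<close>.\<close>

lemma truncated_ramification_index:
  fixes n :: nat
  defines "\<xi> \<equiv> the_enat (min (ramification_index \<nu>) (enat n))"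
  assumes "n \<ge> 1"
  shows "0 < \<xi>" "\<xi> \<le> n"
    "val_ge \<nu> 0 x \<Longrightarrow>
      val_ge \<nu> (int n) (of_nat (residue_char \<nu>) * x) \<longleftrightarrow> val_ge \<nu> (int (n - \<xi>)) x"
proof -
  let ?p = "of_nat (residue_char \<nu>) :: 'a"
  have "0 < \<xi> \<and> \<xi> \<le> n \<and> (val_ge \<nu> 0 x \<longrightarrow>
      (val_ge \<nu> (int n) (?p * x) \<longleftrightarrow> val_ge \<nu> (int (n - \<xi>)) x))" for x
  proof (cases "?p = 0")
    case True
    \<comment> \<open>Here the ramification index is infinite, and both sides of the equivalence
      hold for every integral \<open>x\<close>.\<close>
    then have "\<xi> = n" by (simp add: \<xi>_def ramification_index_def)
    then show ?thesis using True assms(2) by simp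
  next
    case False
    define e where "e = nat (\<nu> ?p)"
    have e: "\<nu> ?p = int e" "e \<ge> 1" using residue_char(2) False by (auto simp: val_ge_def e_def)
    have "\<xi> = min e n" using False by (simp add: \<xi>_def ramification_index_def e_def)
    then show ?thesis
      using e assms(2) False by (cases "x = 0") (auto simp: val_ge_def val_mult)
  qed
  then show "0 < \<xi>" "\<xi> \<le> n"
    "val_ge \<nu> 0 x \<Longrightarrow> val_ge \<nu> (int n) (?p * x) \<longleftrightarrow> val_ge \<nu> (int (n - \<xi>)) x"
    by blast+
qed

lemma finite_chain_ring_O_mod:
  assumes n: "n \<ge> 1"
  shows "finite_chain_ring (O_mod \<nu> n) (filt n) (residue_char \<nu>) (inertia_degree \<nu>) n
    (the_enat (min (ramification_index \<nu>) (enat n)))"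
proof -
  let ?\<xi> = "the_enat (min (ramification_index \<nu>) (enat n))"
  note \<xi> = truncated_ramification_index[OF n]
  have ideal: "ideal (filt n i) (O_mod \<nu> n)" for i
    using O.ring_ideal_imp_quot_ideal[OF ideal_max_ideal_pow[of n] ideal_max_ideal_pow[of i]]
    by (simp add: filt_def O_mod_def cls_def[abs_def])
  show ?thesis
  proof (intro finite_chain_ring.intro cring_O_mod finite_chain_ring_axioms.intro, goal_cases)
    case 1 show ?case by (rule prime_residue_char)
  next
    case 2 show ?case by (rule inertia_degree_pos)
  next
    case 3 show ?case by (rule \<xi>(1))
  next
    case 4 show ?case by (rule \<xi>(2))
  next
    case 5 show ?case using finite_filt_card[OF fin, of 0 n] by (simp add: filt_zero)
  next
    case (6 i) show ?case by (rule ideal)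
  next
    case 7 show ?case by (rule filt_zero)
  next
    case 8 show ?case by (rule filt_top)
  next
    case (9 i)
    have "max_ideal_pow \<nu> (Suc i) \<subseteq> max_ideal_pow \<nu> i"
      unfolding max_ideal_pow_def using val_ge_mono[of "int (Suc i)" _ "int i"] by auto
    then show ?case unfolding filt_def by (rule image_mono)
  next
    case (10 i) then show ?case using finite_filt_card[OF fin] by (simp add: residue_card_eq)
  next
    case (11 Y m X)
    obtain y where y: "Y = cls n y" "val_ge \<nu> 0 y" using 11(1) by (auto simp: carrier_O_mod)
    obtain x where x: "X = cls n x" "val_ge \<nu> (int m) x" using 11(3) by (auto simp: filt_def mem_max_ideal_pow)
    have "\<not> val_ge \<nu> (int (Suc m)) y" using 11(2) y by (auto simp: filt_def mem_max_ideal_pow)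
    \<comment> \<open>The valuation of \<open>y\<close> is at most \<open>m\<close>, hence at most
      that of a nonzero \<open>x\<close>, so the quotient \<open>x / y\<close> is integral.\<close>
    then have y0: "y \<noteq> 0" "\<nu> y \<le> int m" by (auto simp: val_ge_def)
    have r: "val_ge \<nu> 0 (x / y)" using x(2) y0 val_divide[of x y] by (cases "x = 0") (auto simp: val_ge_def)
    have "X = cls n (x / y) \<otimes>\<^bsub>O_mod \<nu> n\<^esub> Y" using cls_ring(2)[OF r y(2)] y x y0 by simp
    then show ?case using r by (auto simp: carrier_O_mod)
  next
    case (12 X)
    then obtain x where x: "X = cls n x" "val_ge \<nu> 0 x" by (auto simp: carrier_O_mod)
    then show ?case
      using \<xi>(3)[OF x(2)] cls_eq_iff[of n _ 0] by (simp add: cls_add_pow cls_zero cls_in_filt_iff)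
  next
    case (13 X i)
    then obtain x where x: "X = cls n x" "val_ge \<nu> (int i) x" by (auto simp: filt_def mem_max_ideal_pow)
    then have "val_ge \<nu> 0 x" by (auto intro: val_ge_int)
    then show ?case
      using x val_ge_mult[OF residue_char(2) x(2)] by (auto simp: cls_add_pow filt_def mem_max_ideal_pow)
  qed
qed

end

end

theorem theorem1p1:
  fixes \<nu> :: "'a::field \<Rightarrow> int" and k n :: nat
  assumes "nonarch_local_field \<nu>" and "k \<ge> 1" and "n \<ge> 1"
  shows "m_faithful (Hei k (O_mod \<nu> n)) =
           (\<Sum>i<the_enat (min (ramification_index \<nu>) (enat n)).
              inertia_degree \<nu> * residue_card \<nu> ^ (k * (n - i)))"
proof -
  interpret discretely_valued_field \<nu>
    by unfold_locales (use assms(1) in \<open>simp add: nonarch_local_field_def\<close>)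
  have fin: "finite (carrier (O_mod \<nu> 1))" using assms(1) by (simp add: nonarch_local_field_def)
  show ?thesis
    using finite_chain_ring.m_faithful_Hei[OF finite_chain_ring_O_mod[OF fin assms(3)]]
    by (simp add: residue_card_eq[OF fin])
qed

end
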